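(* Suppose that $WZ^{-1}$ is $SU(1,1)$-conjugate to a diagonal matrix $\begin{pmatrix}\lambda_1&0\\0&\lambda_2\end{pmatrix}$. We have the following matrix coefficient expansions for the reproducing kernels of ${\cal D}^h_<$, ${\cal D}^h_>$, ${\cal D}^a_<$ and ${\cal D}^a_>$ respectively: 1. When $WZ^{-1}\in\Gamma^-$ and $|N(WZ^{-1})|>1$, we have a pointwise absolutely convergent series $$\sum_{\substack{k,l,m,n\\ m,n\ge -l\ge 1\\ k\le -1}} -(2l+1)\,\tau^l_{n\,\underline{m}}(W)\cdot N(W)^k\cdot\tau^l_{m\,\underline{n}}(Z^{-1})\cdot N(Z)^{-k-2}=\frac{-N(Z)^{-2}\cdot\lambda_1}{(\lambda_1-\lambda_2)(1-\lambda_1\lambda_2)(1-\lambda_1)^2};$$ 2. When $WZ^{-1}\in\Gamma^-$ and $|N(WZ^{-1})|<1$, we have a pointwise absolutely convergent series $$\sum_{\substack{k,l,m,n\\ m,n\ge -l\ge 1\\ k\ge -(2l+1)}} -(2l+1)\,\tau^l_{n\,\underline{m}}(W)\cdot N(W)^k\cdot\tau^l_{m\,\underline{n}}(Z^{-1})\cdot N(Z)^{-k-2}=\frac{-N(Z)^{-2}\cdot\lambda_2}{(\lambda_1-\lambda_2)(1-\lambda_1\lambda_2)(1-\lambda_2)^2};$$ 3. When $WZ^{-1}\in\Gamma^+$ and $|N(WZ^{-1})|>1$, we have a pointwise absolutely convergent series $$\sum_{\substack{k,l,m,n\\ m,n\le l\le -1\\ k\le -1}} -(2l+1)\,\tau^l_{n\,\underline{m}}(W)\cdot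 N(W)^k\cdot\tau^l_{m\,\underline{n}}(Z^{-1})\cdot N(Z)^{-k-2}=\frac{N(Z)^{-2}\cdot\lambda_2}{(\lambda_1-\lambda_2)(1-\lambda_1\lambda_2)(1-\lambda_2)^2};$$ 4. When $WZ^{-1}\in\Gamma^+$ and $|N(WZ^{-1})|<1$, we have a pointwise absolutely convergent series $$\sum_{\substack{k,l,m,n\\ m,n\le l\le -1\\ k\ge -(2l+1)}} -(2l+1)\,\tau^l_{n\,\underline{m}}(W)\cdot N(W)^k\cdot\tau^l_{m\,\underline{n}}(Z^{-1})\cdot N(Z)^{-k-2}=\frac{N(Z)^{-2}\cdot\lambda_1}{(\lambda_1-\lambda_2)(1-\lambda_1\lambda_2)(1-\lambda_1)^2}.$$ The sums are taken first over all $m$, $n$, then over $k$, and then over $l=-1,-\frac32,-2,-\frac52,\dots$.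
   Context: $\mathbb H_{\mathbb C}$ is the algebra of $2\times 2$ complex matrices $Z=\begin{pmatrix} z_{11}&z_{12}\\ z_{21}&z_{22}\end{pmatrix}$ (complexified quaternions), $N(Z)=\det Z$, and $Z,W$ denote elements of $\mathbb H_{\mathbb C}$. $SU(1,1)=\{Z\in\mathbb H_{\mathbb C}:\ z_{22}=\overline{z_{11}},\ z_{21}=\overline{z_{12}},\ N(Z)=1\}$. Matrix coefficients of the discrete series representations of $SU(1,1)$: for $l=-1,-\frac32,-2,-\frac52,\dots$ and $m,n\in\mathbb Z+l$ with either $m,n\ge -l$ (holomorphic discrete series) or $m,n\le l$ (antiholomorphic discrete series), $$\tau^l_{n\,\underline{m}}(Z)=\frac1{2\pi i}\oint (sz_{11}+z_{21})^{l-m}(sz_{12}+z_{22})^{l+m}s^{-l+n}\,\frac{ds}{s},$$ the integral being over the unit circle $|s|=1$ traversed once counterclockwise; these are regarded as rational functions on $\mathbb H_{\mathbb C}$ (the rational functions of the $z_{ij}$ which the integral gives on $SU(1,1)$). The sets $\Gamma^\pm$ (open Ol'shanskii semigroups) are $$\Gamma^-=\left\{g\begin{pmatrix}\lambda_1&0\\0&\lambda_2\end{pmatrix}g^{-1}\in GL(2,\mathbb C);\ g\in SU(1,1),\ \lambda_1,\lambda_2\in\mathbb C,\ |\lambda_1|>1>|\lambda_2|>0\right\},$$ $$\Gamma^+=\left\{g\begin{pmatrix}\lambda_1&0\\0&\lambda_2\end{pmatrix}g^{-1}\in GL(2,\mathbb C);\ g\in SU(1,1),\ \lambda_1,\lambda_2\in\mathbb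 C,\ |\lambda_2|>1>|\lambda_1|>0\right\}.$$ "$SU(1,1)$-conjugate to a diagonal matrix" means equal to $g\,\mathrm{diag}(\lambda_1,\lambda_2)\,g^{-1}$ for some $g\in SU(1,1)$; $|\lambda_1|>1>|\lambda_2|>0$ when $WZ^{-1}\in\Gamma^-$ and $|\lambda_2|>1>|\lambda_1|>0$ when $WZ^{-1}\in\Gamma^+$. The spaces ${\cal D}^h_<$, ${\cal D}^h_>$, ${\cal D}^a_<$, ${\cal D}^a_>$ are the $\mathbb C$-spans of the functions $\tau^l_{n\,\underline{m}}(Z)\cdot N(Z)^k$ with, respectively: $m,n\ge -l,\ k\le -1$; $m,n\ge -l,\ k\ge -(2l+1)$; $m,n\le l,\ k\le -1$; $m,n\le l,\ k\ge -(2l+1)$ (with $l=-1,-\frac32,-2,\dots$, $m,n\in\mathbb Z+l$, $k\in\mathbb Z$). The "reproducing kernel" of such a space is the function of $(Z,W)$ given by the corresponding series in the claim.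
   Formalization: The printed right-hand signs in cases 2 and 4 are wrong and are reversed here; it is also assumed that W maps a disc |t|≤a into |t|<b and Z^{-1} maps |t|≤b into |t|<a as Moebius maps (automatic for Z in C*SU(1,1)), since otherwise the sum over m,n can diverge or meet poles. *)

theory Defs
  imports "HOL-Complex_Analysis.Complex_Analysis"
begin

no_notation fps_nth (infixl "$" 75)

definition SU11 :: "(complex^2^2) set"
  where "SU11 = {Z. Z$2$2 = cnj (Z$1$1) \<and> Z$2$1 = cnj (Z$1$2) \<and> det Z = 1}"

definition diag2 :: "complex \<Rightarrow> complex \<Rightarrow> complex^2^2"
  where "diag2 a b = vector [vector [a, 0], vector [0, b]]"

definition Gamma_minus :: "(complex^2^2) set" where
  "Gamma_minus = {g ** diag2 a b ** matrix_inv g | g a b.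
     g \<in> SU11 \<and> cmod a > 1 \<and> 1 > cmod b \<and> cmod b > 0}"

definition Gamma_plus :: "(complex^2^2) set" where
  "Gamma_plus = {g ** diag2 a b ** matrix_inv g | g a b.
     g \<in> SU11 \<and> cmod b > 1 \<and> 1 > cmod a \<and> cmod a > 0}"

(* The spins l = -1, -3/2, -2, -5/2, ... and, for given l, the weights m in Z + l
   of the holomorphic and antiholomorphic discrete series. *)

definition spins :: "real set"
  where "spins = {- 1 - real j / 2 | j. True}"

definition hol_weights :: "real \<Rightarrow> real set"
  where "hol_weights l = {m. m - l \<in> \<int> \<and> m \<ge> - l}"

definition antihol_weights :: "real \<Rightarrow> real set"
  where "antihol_weights l = {m. m - l \<in> \<int> \<and> m \<le> l}"

(* For weights m, n in Z + l and 2l an integer, the numbers l - m, l + m, n - l are integers,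
   so the floors below only convert their type. *)

definition tau_integral :: "real \<Rightarrow> real \<Rightarrow> real \<Rightarrow> complex^2^2 \<Rightarrow> complex" where
  "tau_integral l n m Z =
     contour_integral (circlepath 0 1)
       (\<lambda>s. (s * Z$1$1 + Z$2$1) powi \<lfloor>l - m\<rfloor> * (s * Z$1$2 + Z$2$2) powi \<lfloor>l + m\<rfloor>
            * s powi \<lfloor>n - l\<rfloor> / s) / (2 * of_real pi * \<i>)"

inductive_set matrix_poly :: "(complex^2^2 \<Rightarrow> complex) set" where
  const: "(\<lambda>Z. c) \<in> matrix_poly"
| entry: "(\<lambda>Z. Z$i$j) \<in> matrix_poly"
| add: "p \<in> matrix_poly \<Longrightarrow> q \<in> matrix_poly \<Longrightarrow> (\<lambda>Z. p Z + q Z) \<in> matrix_poly"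
| mult: "p \<in> matrix_poly \<Longrightarrow> q \<in> matrix_poly \<Longrightarrow> (\<lambda>Z. p Z * q Z) \<in> matrix_poly"

(* rational_value f S Z c: the rational function P/Q that agrees with f near S takes the
   value c = P(Z)/Q(Z) at Z.  Agreement is required on an open neighbourhood of S because
   SU11 lies on the hypersurface det = 1, so that the values on SU11 alone do not determine
   a rational function of the four matrix entries. *)

definition rational_value ::
    "(complex^2^2 \<Rightarrow> complex) \<Rightarrow> (complex^2^2) set \<Rightarrow> complex^2^2 \<Rightarrow> complex \<Rightarrow> bool" where
  "rational_value f S Z c \<longleftrightarrow>
     (\<exists>P\<in>matrix_poly. \<exists>Q\<in>matrix_poly. \<exists>U. open U \<and> S \<subseteq> U \<and> (\<forall>Y\<in>U. Q Y * f Y = P Y)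
        \<and> Q Z \<noteq> 0 \<and> c = P Z / Q Z)"

(* Unspecified at the poles. *)

definition tau :: "real \<Rightarrow> real \<Rightarrow> real \<Rightarrow> complex^2^2 \<Rightarrow> complex"
  where "tau l n m Z = (THE c. rational_value (tau_integral l n m) SU11 Z c)"

definition kernel_term ::
    "complex^2^2 \<Rightarrow> complex^2^2 \<Rightarrow> real \<Rightarrow> int \<Rightarrow> real \<Rightarrow> real \<Rightarrow> complex" where
  "kernel_term W Z l k m n =
     of_real (- (2 * l + 1)) * tau l n m W * det W powi k
       * tau l m n (matrix_inv Z) * det Z powi (- k - 2)"

(* Absolute convergence of a sum over m, n in M(l), then k in K(l), then l in L, to the value S. *)

definition has_abs_iterated_sum ::
    "(real \<Rightarrow> int \<Rightarrow> real \<Rightarrow> real \<Rightarrow> complex) \<Rightarrow> real set \<Rightarrow> (real \<Rightarrow> int set)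
       \<Rightarrow> (real \<Rightarrow> real set) \<Rightarrow> complex \<Rightarrow> bool" where
  "has_abs_iterated_sum f L K M S \<longleftrightarrow>
     (\<forall>l\<in>L. \<forall>k\<in>K l. (\<lambda>(m, n). norm (f l k m n)) summable_on M l \<times> M l) \<and>
     (\<forall>l\<in>L. (\<lambda>k. norm (\<Sum>\<^sub>\<infinity>(m, n)\<in>M l \<times> M l. f l k m n)) summable_on K l) \<and>
     (\<lambda>l. norm (\<Sum>\<^sub>\<infinity>k\<in>K l. \<Sum>\<^sub>\<infinity>(m, n)\<in>M l \<times> M l. f l k m n)) summable_on L \<and>
     ((\<lambda>l. \<Sum>\<^sub>\<infinity>k\<in>K l. \<Sum>\<^sub>\<infinity>(m, n)\<in>M l \<times> M l. f l k m n) has_sum S) L"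

(* The Moebius map t |-> (X_ij + X_jj t) / (X_ii + X_ji t) is defined on the closed disc of
   radius a and maps it into the open disc of radius b. *)

definition maps_disc :: "2 \<Rightarrow> 2 \<Rightarrow> complex^2^2 \<Rightarrow> real \<Rightarrow> real \<Rightarrow> bool" where
  "maps_disc i j X a b \<longleftrightarrow>
     (\<forall>t. cmod t \<le> a \<longrightarrow> cmod (X$i$j + X$j$j * t) < b * cmod (X$i$i + X$j$i * t))"

(* W acts by a power series expansion in a disc, and the inverse of Z acts on the result.
   This is what makes the products tau(W) tau(inverse of Z) summable over m and n; for arbitrary
   W and Z with W Z^(-1) in Gamma_minus or Gamma_plus the factors may have poles and the sum
   over m and n may diverge.  The case i = 1, j = 2 is for the holomorphic series
   (t = 1/s in the integral), the case i = 2, j = 1 for the antiholomorphic series (t = s).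
   It is automatic when Z is a nonzero multiple of an element of SU11: composable_minus and
   composable_plus below. *)

definition composable :: "2 \<Rightarrow> 2 \<Rightarrow> complex^2^2 \<Rightarrow> complex^2^2 \<Rightarrow> bool" where
  "composable i j W Z \<longleftrightarrow>
     (\<exists>a>0. \<exists>b>0. maps_disc i j W a b \<and> maps_disc i j (matrix_inv Z) b a)"

lemma matrix_poly_closure:
  "(\<lambda>Z. - Z$i$j) \<in> matrix_poly"
  "p \<in> matrix_poly \<Longrightarrow> (\<lambda>Z. p Z ^ k) \<in> matrix_poly"
  "p \<in> matrix_poly \<Longrightarrow> q \<in> matrix_poly \<Longrightarrow> (\<lambda>Z. p Z - q Z) \<in> matrix_poly"
proof -
  have neg: "(\<lambda>Z. - p Z) \<in> matrix_poly" if "p \<in> matrix_poly" for p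
    using matrix_poly.mult[OF matrix_poly.const[of "-1"] that] by simp
  show "(\<lambda>Z. - Z$i$j) \<in> matrix_poly"
    by (rule neg) (rule matrix_poly.entry)
  show "(\<lambda>Z. p Z ^ k) \<in> matrix_poly" if "p \<in> matrix_poly"
    by (induction k) (auto intro: matrix_poly.const matrix_poly.mult that)
  show "(\<lambda>Z. p Z - q Z) \<in> matrix_poly" if "p \<in> matrix_poly" "q \<in> matrix_poly"
    using matrix_poly.add[OF that(1) neg[OF that(2)]] by simp
qed

lemma matrix_poly_sum:
  assumes "finite I" "\<And>x. x \<in> I \<Longrightarrow> (\<lambda>Z. f x Z) \<in> matrix_poly"
  shows "(\<lambda>Z. \<Sum>x\<in>I. f x Z) \<in> matrix_poly"
  using assms by (induction I rule: finite_induct) (auto intro: matrix_poly.const matrix_poly.add)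

lemma matrix_poly_line:
  assumes "p \<in> matrix_poly"
  shows "\<exists>q. \<forall>t. p (\<chi> i j. A$i$j + t * B$i$j) = poly q t"
  using assms
proof induction
  case (const c)
  show ?case by (rule exI[of _ "[:c:]"]) simp
next
  case (entry i j)
  show ?case by (rule exI[of _ "[:A$i$j, B$i$j:]"]) simp
next
  case (add p q)
  then obtain p' q' where "\<forall>t. p (\<chi> i j. A$i$j + t * B$i$j) = poly p' t"
    "\<forall>t. q (\<chi> i j. A$i$j + t * B$i$j) = poly q' t" by blast
  then show ?case by (intro exI[of _ "p' + q'"]) simp
next
  case (mult p q)
  then obtain p' q' where "\<forall>t. p (\<chi> i j. A$i$j + t * B$i$j) = poly p' t"
    "\<forall>t. q (\<chi> i j. A$i$j + t * B$i$j) = poly q' t" by blast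
  then show ?case by (intro exI[of _ "p' * q'"]) simp
qed

lemma matrix_poly_zero:
  assumes p: "p \<in> matrix_poly" and U: "open U" "A \<in> U" "\<And>Y. Y \<in> U \<Longrightarrow> p Y = 0"
  shows "p Z = 0"
proof -
  define L where "L = (\<lambda>t::complex. \<chi> i j. A$i$j + t * (Z - A)$i$j)"
  obtain q where q: "\<And>t. p (L t) = poly q t"
    using matrix_poly_line[OF p, of A "Z - A"] by (auto simp: L_def)
  have L0: "L 0 = A" and L1: "L 1 = Z" by (simp_all add: L_def vec_eq_iff)
  have "continuous_on UNIV L"
    unfolding L_def by (intro continuous_intros continuous_on_vec_lambda)
  then have "open (L -` U)" using U(1) by (simp add: continuous_on_open_vimage)
  moreover have "0 \<in> L -` U" using L0 U(2) by simp
  ultimately have "infinite (L -` U)"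
    using finite_imp_not_open by blast
  moreover have "L -` U \<subseteq> {t. poly q t = 0}" using U(3) by (auto simp flip: q)
  ultimately have "q = 0" using poly_roots_finite finite_subset by blast
  then show ?thesis using q[of 1] L1 by simp
qed

lemma mat_1_in_SU11: "mat 1 \<in> SU11"
  by (simp add: SU11_def mat_def det_2)

lemma rational_value_unique:
  assumes "A \<in> S" "rational_value f S Z c" "rational_value f S Z d"
  shows "c = d"
proof -
  from assms(2) obtain P Q U where 1: "P \<in> matrix_poly" "Q \<in> matrix_poly" "open U" "S \<subseteq> U"
      "\<forall>Y\<in>U. Q Y * f Y = P Y" "Q Z \<noteq> 0" "c = P Z / Q Z"
    unfolding rational_value_def by blast
  from assms(3) obtain P' Q' U' where 2: "P' \<in> matrix_poly" "Q' \<in> matrix_poly" "open U'" "S \<subseteq> U'"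
      "\<forall>Y\<in>U'. Q' Y * f Y = P' Y" "Q' Z \<noteq> 0" "d = P' Z / Q' Z"
    unfolding rational_value_def by blast
  have "P Z * Q' Z - P' Z * Q Z = 0"
  proof (rule matrix_poly_zero[where U = "U \<inter> U'" and A = A and p = "\<lambda>Z. P Z * Q' Z - P' Z * Q Z"])
    show "(\<lambda>Z. P Z * Q' Z - P' Z * Q Z) \<in> matrix_poly"
      by (intro matrix_poly_closure matrix_poly.mult 1 2)
    show "open (U \<inter> U')" using 1 2 by auto
    show "A \<in> U \<inter> U'" using 1 2 assms(1) by auto
    show "P Y * Q' Y - P' Y * Q Y = 0" if "Y \<in> U \<inter> U'" for Y
    proof -
      have "P Y = Q Y * f Y" "P' Y = Q' Y * f Y" using 1 2 that by auto
      then show ?thesis by simp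
    qed
  qed
  then show ?thesis using 1(6,7) 2(6,7) by (simp add: frac_eq_eq)
qed

lemma tau_eqI:
  assumes "rational_value (tau_integral l n m) SU11 Z c"
  shows "tau l n m Z = c"
  unfolding tau_def using assms rational_value_unique[OF mat_1_in_SU11] by (intro the_equality)

(* The residue of the integrand at s = -z21/z11, with m - l = k + 1, l + m = B, n - l = C + 1. *)

definition tau_sum :: "nat \<Rightarrow> nat \<Rightarrow> nat \<Rightarrow> complex^2^2 \<Rightarrow> complex" where
  "tau_sum B C k Z = (\<Sum>i | i \<le> B \<and> k \<le> i + C. of_nat (B choose i) * of_nat ((i + C) choose k)
     * Z$1$2 ^ i * Z$2$2 ^ (B - i) * (- Z$2$1) ^ (i + C - k) / Z$1$1 ^ (i + C + 1))"

lemma higher_deriv_power_binomial: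
  fixes w :: complex
  shows "(deriv ^^ k) (\<lambda>w. w ^ d) w = fact k * of_nat (d choose k) * w ^ (d - k)"
proof -
  have "pochhammer (of_nat (Suc d - k)) k = (fact k * of_nat (d choose k) :: complex)"
  proof (cases "k \<le> d")
    case True
    have "(of_nat (d choose k) :: complex) = pochhammer (of_nat d - of_nat k + 1) k / fact k"
      by (simp add: binomial_gbinomial gbinomial_pochhammer')
    then show ?thesis using True by (simp add: Suc_diff_le of_nat_diff add.commute)
  next
    case False
    then have "Suc d - k = 0" "d choose k = 0" "k \<noteq> 0" by (auto simp: binomial_eq_0)
    then show ?thesis by (simp add: pochhammer_0_left)
  qed
  then show ?thesis using higher_deriv_power[of k 0 d w] by simp
qed

lemma tau_integral_eq_sum:
  assumes fl: "\<lfloor>l - m\<rfloor> = - int (Suc k)" "\<lfloor>l + m\<rfloor> = int B" "\<lfloor>n - l\<rfloor> = int (Suc C)"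
    and Z: "cmod (Z$2$1) < cmod (Z$1$1)"
  shows "tau_integral l n m Z = tau_sum B C k Z"
proof -
  have nz: "Z$1$1 \<noteq> 0" using Z by auto
  define w where "w = - Z$2$1 / Z$1$1"
  have w: "w \<in> ball 0 1" using Z nz by (simp add: w_def norm_divide)
  define a where "a i = of_nat (B choose i) * Z$1$2 ^ i * Z$2$2 ^ (B - i) / Z$1$1 ^ Suc k" for i
  have one: "((\<lambda>u. u ^ d / (u - w) ^ Suc k) has_contour_integral
          (2 * pi * \<i>) * (of_nat (d choose k) * w ^ (d - k))) (circlepath 0 1)" for d
    using Cauchy_has_contour_integral_higher_derivative_circlepath[of 0 1 "\<lambda>u. u ^ d" w k] w
    by (simp add: higher_deriv_power_binomial continuous_intros holomorphic_intros mult.assoc)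
  have "((\<lambda>u. \<Sum>i\<le>B. a i * (u ^ (i + C) / (u - w) ^ Suc k)) has_contour_integral
          (\<Sum>i\<le>B. a i * ((2 * pi * \<i>) * (of_nat ((i + C) choose k) * w ^ (i + C - k))))) (circlepath 0 1)"
    by (intro has_contour_integral_sum has_contour_integral_lmul one) auto
  then have "((\<lambda>s. (s * Z$1$1 + Z$2$1) powi \<lfloor>l - m\<rfloor> * (s * Z$1$2 + Z$2$2) powi \<lfloor>l + m\<rfloor>
            * s powi \<lfloor>n - l\<rfloor> / s) has_contour_integral
          (\<Sum>i\<le>B. a i * ((2 * pi * \<i>) * (of_nat ((i + C) choose k) * w ^ (i + C - k))))) (circlepath 0 1)"
  proof (rule has_contour_integral_eq)
    fix s :: complex assume "s \<in> path_image (circlepath 0 1)"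
    then have s: "s \<noteq> 0" by auto
    have e: "s * Z$1$1 + Z$2$1 = Z$1$1 * (s - w)" using nz by (simp add: w_def field_simps)
    have p: "(Z$1$1 * (s - w)) powi (- int (Suc k)) = 1 / (Z$1$1 ^ Suc k * (s - w) ^ Suc k)"
      unfolding power_int_minus power_int_of_nat power_mult_distrib by (simp add: divide_inverse)
    have b: "(s * Z$1$2 + Z$2$2) ^ B = (\<Sum>i\<le>B. of_nat (B choose i) * (s * Z$1$2) ^ i * Z$2$2 ^ (B - i))"
      by (rule binomial_ring)
    have c: "s powi int (Suc C) / s = s ^ C" unfolding power_int_of_nat using s by simp
    have "(s * Z$1$1 + Z$2$1) powi \<lfloor>l - m\<rfloor> * (s * Z$1$2 + Z$2$2) powi \<lfloor>l + m\<rfloor> * s powi \<lfloor>n - l\<rfloor> / s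
      = 1 / (Z$1$1 ^ Suc k * (s - w) ^ Suc k) * (s * Z$1$2 + Z$2$2) ^ B * s ^ C"
      unfolding fl e p power_int_of_nat[of _ B] using c by (metis times_divide_eq_right)
    also have "\<dots> = (\<Sum>i\<le>B. a i * (s ^ (i + C) / (s - w) ^ Suc k))"
      unfolding b sum_distrib_left sum_distrib_right
      by (rule sum.cong) (auto simp: a_def power_mult_distrib power_add)
    finally show "(\<Sum>i\<le>B. a i * (s ^ (i + C) / (s - w) ^ Suc k)) =
      (s * Z$1$1 + Z$2$1) powi \<lfloor>l - m\<rfloor> * (s * Z$1$2 + Z$2$2) powi \<lfloor>l + m\<rfloor> * s powi \<lfloor>n - l\<rfloor> / s" ..
  qed
  from contour_integral_unique[OF this]
  have "tau_integral l n m Z = (\<Sum>i\<le>B. a i * ((2 * pi * \<i>) * (of_nat ((i + C) choose k) * w ^ (i + C - k))))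
      / (2 * of_real pi * \<i>)"
    unfolding tau_integral_def by (rule arg_cong)
  also have "\<dots> = (\<Sum>i\<le>B. a i * (of_nat ((i + C) choose k) * w ^ (i + C - k)))"
  proof -
    have "x * ((2 * pi * \<i>) * y) / (2 * of_real pi * \<i>) = x * y" for x y :: complex
    proof -
      have "x * ((2 * pi * \<i>) * y) / (2 * of_real pi * \<i>) = (x * y) * (2 * pi * \<i>) / (2 * pi * \<i>)"
        by (simp only: of_real_mult of_real_numeral mult_ac)
      also have "\<dots> = x * y" by (rule nonzero_mult_div_cancel_right) simp
      finally show ?thesis .
    qed
    then show ?thesis unfolding sum_divide_distrib by (intro sum.cong refl)
  qed
  also have "\<dots> = (\<Sum>i | i \<le> B \<and> k \<le> i + C. a i * (of_nat ((i + C) choose k) * w ^ (i + C - k)))"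
    by (rule sum.mono_neutral_right) (auto simp: binomial_eq_0)
  also have "\<dots> = tau_sum B C k Z"
    unfolding tau_sum_def
  proof (rule sum.cong[OF refl])
    fix i assume "i \<in> {i. i \<le> B \<and> k \<le> i + C}"
    then have e: "Z$1$1 ^ (i + C + 1) = Z$1$1 ^ Suc k * Z$1$1 ^ (i + C - k)"
      by (simp flip: power_add)
    show "a i * (of_nat ((i + C) choose k) * w ^ (i + C - k)) = of_nat (B choose i) * of_nat ((i + C) choose k)
     * Z$1$2 ^ i * Z$2$2 ^ (B - i) * (- Z$2$1) ^ (i + C - k) / Z$1$1 ^ (i + C + 1)"
      unfolding e a_def w_def power_divide by (simp only: times_divide_eq_left times_divide_eq_right divide_divide_eq_left mult_ac)
  qed
  finally show ?thesis .
qed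

lemma open_entry: "open {Z::complex^2^2. cmod (Z$i$j) < cmod (Z$k$l)}"
  by (intro open_Collect_less continuous_intros)

lemma SU11_entry: "Z \<in> SU11 \<Longrightarrow> cmod (Z$2$1) < cmod (Z$1$1)"
proof -
  assume Z: "Z \<in> SU11"
  have "complex_of_real ((cmod (Z$1$1))\<^sup>2 - (cmod (Z$1$2))\<^sup>2) = det Z"
    using Z unfolding SU11_def det_2 of_real_diff complex_norm_square by simp
  also have "\<dots> = 1" using Z by (simp add: SU11_def)
  finally have "(cmod (Z$1$1))\<^sup>2 - (cmod (Z$1$2))\<^sup>2 = 1" using of_real_eq_1_iff by blast
  then have "(cmod (Z$1$2))\<^sup>2 < (cmod (Z$1$1))\<^sup>2" by simp
  then have "cmod (Z$1$2) < cmod (Z$1$1)" by (rule power_less_imp_less_base) simp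
  then show ?thesis using Z by (simp add: SU11_def)
qed

lemma rational_value_tau_sum:
  assumes fl: "\<lfloor>l - m\<rfloor> = - int (Suc k)" "\<lfloor>l + m\<rfloor> = int B" "\<lfloor>n - l\<rfloor> = int (Suc C)"
    and Z: "Z$1$1 \<noteq> 0"
  shows "rational_value (tau_integral l n m) SU11 Z (tau_sum B C k Z)"
proof -
  define P where "P Z = (\<Sum>i | i \<le> B \<and> k \<le> i + C. of_nat (B choose i) * of_nat ((i + C) choose k)
     * Z$1$2 ^ i * Z$2$2 ^ (B - i) * (- Z$2$1) ^ (i + C - k) * Z$1$1 ^ (B - i))" for Z :: "complex^2^2"
  define Q where "Q Z = Z$1$1 ^ (B + C + 1)" for Z :: "complex^2^2"
  have PQ: "Q Y * tau_sum B C k Y = P Y" if "Y$1$1 \<noteq> 0" for Y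
    unfolding P_def Q_def tau_sum_def sum_distrib_left
  proof (rule sum.cong[OF refl])
    fix i assume "i \<in> {i. i \<le> B \<and> k \<le> i + C}"
    then have "Y$1$1 ^ (B + C + 1) = Y$1$1 ^ (B - i) * Y$1$1 ^ (i + C + 1)"
      by (simp flip: power_add)
    then show "Y$1$1 ^ (B + C + 1) * (of_nat (B choose i) * of_nat ((i + C) choose k)
     * Y$1$2 ^ i * Y$2$2 ^ (B - i) * (- Y$2$1) ^ (i + C - k) / Y$1$1 ^ (i + C + 1)) =
      of_nat (B choose i) * of_nat ((i + C) choose k)
     * Y$1$2 ^ i * Y$2$2 ^ (B - i) * (- Y$2$1) ^ (i + C - k) * Y$1$1 ^ (B - i)"
      using that by simp
  qed
  show ?thesis unfolding rational_value_def
  proof (rule bexI[of _ P], rule bexI[of _ Q], intro exI[of _ "{Z. cmod (Z$2$1) < cmod (Z$1$1)}"] conjI ballI)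
    show "P \<in> matrix_poly" unfolding P_def
      by (intro matrix_poly_sum matrix_poly_closure matrix_poly.mult matrix_poly.const matrix_poly.entry)
         (auto intro!: finite_subset[of _ "{..B}"])
    show "Q \<in> matrix_poly" unfolding Q_def by (intro matrix_poly_closure matrix_poly.entry)
    show "Q Z \<noteq> 0" using Z by (simp add: Q_def)
    then show "tau_sum B C k Z = P Z / Q Z" using PQ[OF Z] by (simp add: field_simps)
    show "Q Y * tau_integral l n m Y = P Y" if "Y \<in> {Z. cmod (Z$2$1) < cmod (Z$1$1)}" for Y
    proof -
      have "Y$1$1 \<noteq> 0" using that by auto
      then show ?thesis using PQ tau_integral_eq_sum[OF fl, of Y] that by simp
    qed
  qed (use open_entry SU11_entry in auto)
qed

lemma hol_floors:
  assumes "l \<in> spins" "m \<in> hol_weights l" "n \<in> hol_weights l"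
  obtains k B C where "\<lfloor>l - m\<rfloor> = - int (Suc k)" "\<lfloor>l + m\<rfloor> = int B" "\<lfloor>n - l\<rfloor> = int (Suc C)"
proof -
  obtain j where j: "l = - 1 - real j / 2" using assms(1) by (auto simp: spins_def)
  obtain x y where x: "m - l = of_int x" "m \<ge> -l" and y: "n - l = of_int y" "n \<ge> -l"
    using assms(2,3) unfolding hol_weights_def Ints_def by auto
  have a: "l - m = of_int (-x)" "l + m = of_int (x - 2 - int j)" "n - l = of_int y"
    using x y j by auto
  have b: "x \<ge> 2 + int j" "y \<ge> 2 + int j" using x y j by linarith+
  show thesis
    by (rule that[of "nat (x - 1)" "nat (x - 2 - int j)" "nat (y - 1)"])
       (use a b in \<open>auto simp del: of_int_minus of_int_diff\<close>)
qed

(* The substitution s |-> 1/s exchanges the holomorphic and the antiholomorphic series. *)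

definition swap_indices :: "complex^2^2 \<Rightarrow> complex^2^2" where
  "swap_indices Z = (\<chi> i j. Z $ (if i = 1 then 2 else 1) $ (if j = 1 then 2 else 1))"

lemma swap_indices_entry [simp]:
  "swap_indices Z$1$1 = Z$2$2" "swap_indices Z$1$2 = Z$2$1" "swap_indices Z$2$1 = Z$1$2" "swap_indices Z$2$2 = Z$1$1"
  by (simp_all add: swap_indices_def)

lemma swap_indices_idem [simp]: "swap_indices (swap_indices Z) = Z"
  by (simp add: vec_eq_iff forall_2)

lemma swap_indices_SU11: "Z \<in> SU11 \<Longrightarrow> swap_indices Z \<in> SU11"
  by (auto simp: SU11_def det_2 mult.commute)

lemma swap_indices_poly: "p \<in> matrix_poly \<Longrightarrow> (\<lambda>Z. p (swap_indices Z)) \<in> matrix_poly"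
  by (induction rule: matrix_poly.induct)
     (auto simp: swap_indices_def intro: matrix_poly.intros)

lemma integral_reflect_01:
  fixes f :: "real \<Rightarrow> complex"
  shows "integral {0..1} (\<lambda>x. f (1 - x)) = integral {0..1} f"
proof -
  have "integral {0..1} (\<lambda>x. f (1 - x)) = integral {-1..0} (\<lambda>x. f (- x))"
    using integral_shift_Icc_real[of 0 1 "\<lambda>x. f (- x)" "-1"] by (simp add: o_def)
  also have "\<dots> = integral {0..1} f"
    using Henstock_Kurzweil_Integration.integral_reflect_real[of 1 0 f] by simp
  finally show ?thesis .
qed

lemma tau_integral_swap:
  assumes "m - l = of_int a" "n - l = of_int b" "2 * l = of_int c"
  shows "tau_integral l (- n) (- m) (swap_indices Z) = tau_integral l n m Z"
proof -
  define e where "e x = exp (2 * of_real pi * \<i> * of_real x)" for x :: real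
  define F where "F Y n m s = (s * Y$1$1 + Y$2$1) powi \<lfloor>l - m\<rfloor> * (s * Y$1$2 + Y$2$2) powi \<lfloor>l + m\<rfloor>
            * s powi \<lfloor>n - l\<rfloor> / s" for Y :: "complex^2^2" and n m :: real and s
  have I: "contour_integral (circlepath 0 1) (F Y n m) =
     integral {0..1} (\<lambda>x. F Y n m (e x) * (2 * pi * \<i> * e x))" for Y n m
    unfolding contour_integral_integral vector_derivative_circlepath e_def
    by (simp add: circlepath algebra_simps)
  have fl: "\<lfloor>l - m\<rfloor> = - a" "\<lfloor>l + m\<rfloor> = c + a" "\<lfloor>n - l\<rfloor> = b"
     "\<lfloor>l + - m\<rfloor> = - a" "\<lfloor>l - - m\<rfloor> = c + a" "\<lfloor>- n - l\<rfloor> = - b - c"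
  proof -
    have "l - m = of_int (- a)" "l + m = of_int (c + a)" "l - - m = of_int (c + a)"
      "l + - m = of_int (- a)" "- n - l = of_int (- b - c)"
      using assms by auto
    then show "\<lfloor>l - m\<rfloor> = - a" "\<lfloor>l + m\<rfloor> = c + a" "\<lfloor>n - l\<rfloor> = b"
     "\<lfloor>l + - m\<rfloor> = - a" "\<lfloor>l - - m\<rfloor> = c + a" "\<lfloor>- n - l\<rfloor> = - b - c"
      using assms(2) by (metis floor_of_int)+
  qed
  have "F (swap_indices Z) (-n) (-m) (e (1 - x)) * (2 * pi * \<i> * e (1 - x)) = F Z n m (e x) * (2 * pi * \<i> * e x)" for x
  proof -
    define s where "s = e x"
    have s0: "s \<noteq> 0" by (simp add: s_def e_def)
    have e1: "e (1 - x) = 1 / s"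
      by (simp add: s_def e_def algebra_simps exp_diff)
    have *: "(1 / s * u + v) = inverse s * (s * v + u)" for u v using s0 by (simp add: field_simps)
    have "F (swap_indices Z) (-n) (-m) (1 / s) * (1 / s) = F Z n m s * s"
    proof -
      have "F (swap_indices Z) (-n) (-m) (1 / s) * (1 / s) =
        (1 / s * Z$2$2 + Z$1$2) powi (c + a) * (1 / s * Z$2$1 + Z$1$1) powi (- a) * inverse s powi (- b - c)"
        using s0 by (simp add: F_def fl inverse_eq_divide del: minus_diff_eq)
      also have "\<dots> = (s * Z$1$1 + Z$2$1) powi (- a) * (s * Z$1$2 + Z$2$2) powi (c + a)
        * (inverse s powi (c + a) * inverse s powi (- a) * inverse s powi (- b - c))"
        unfolding * power_int_mult_distrib by (simp add: mult_ac)
      also have "inverse s powi (c + a) * inverse s powi (- a) * inverse s powi (- b - c) = inverse s powi (- b)"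
        using s0 by (subst power_int_add[symmetric], simp)+ simp
      also have "\<dots> = s powi b" by (simp add: power_int_inverse power_int_minus)
      finally show ?thesis using s0 by (simp add: F_def fl)
    qed
    then have "F (swap_indices Z) (-n) (-m) (1 / s) * (1 / s) * (2 * pi * \<i>) = F Z n m s * s * (2 * pi * \<i>)"
      by (rule arg_cong)
    then show ?thesis unfolding e1 s_def[symmetric] by (simp only: mult_ac)
  qed
  then have "integral {0..1} (\<lambda>x. F (swap_indices Z) (-n) (-m) (e x) * (2 * pi * \<i> * e x))
     = integral {0..1} (\<lambda>x. F Z n m (e x) * (2 * pi * \<i> * e x))"
    using integral_reflect_01[of "\<lambda>x. F (swap_indices Z) (-n) (-m) (e x) * (2 * pi * \<i> * e x)"]
    by (simp only:)
  then have "contour_integral (circlepath 0 1) (F (swap_indices Z) (- n) (- m)) = contour_integral (circlepath 0 1) (F Z n m)"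
    unfolding I .
  then show ?thesis unfolding tau_integral_def F_def by simp
qed

lemma rational_value_swap:
  assumes "rational_value f SU11 (swap_indices Z) c"
  shows "rational_value (\<lambda>Z. f (swap_indices Z)) SU11 Z c"
proof -
  obtain P Q U where *: "P \<in> matrix_poly" "Q \<in> matrix_poly" "open U" "SU11 \<subseteq> U"
      "\<forall>Y\<in>U. Q Y * f Y = P Y" "Q (swap_indices Z) \<noteq> 0" "c = P (swap_indices Z) / Q (swap_indices Z)"
    using assms unfolding rational_value_def by blast
  have "open (swap_indices -` U)"
    using *(3) unfolding swap_indices_def
    by (intro continuous_on_open_vimage[THEN iffD1, rule_format, of UNIV, simplified])
       (auto intro!: continuous_intros continuous_on_vec_lambda)
  then show ?thesis unfolding rational_value_def
    by (intro bexI[OF _ swap_indices_poly[OF *(1)]] bexI[OF _ swap_indices_poly[OF *(2)]] exI[of _ "swap_indices -` U"])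
       (use * swap_indices_SU11 in auto)
qed

lemma antihol_swap:
  assumes "l \<in> spins" "m \<in> antihol_weights l" "n \<in> antihol_weights l"
  shows "- m \<in> hol_weights l" "- n \<in> hol_weights l"
    "tau_integral l (- n) (- m) (swap_indices Z) = tau_integral l n m Z"
proof -
  obtain j where j: "l = - 1 - real j / 2" using assms(1) by (auto simp: spins_def)
  obtain a b where a: "m - l = of_int a" "m \<le> l" and b: "n - l = of_int b" "n \<le> l"
    using assms(2,3) unfolding antihol_weights_def Ints_def by auto
  have "- m - l = of_int (2 + int j - a)" "- n - l = of_int (2 + int j - b)" using a b j by auto
  then have "- m - l \<in> \<int>" "- n - l \<in> \<int>" by (metis Ints_of_int)+
  then show "- m \<in> hol_weights l" "- n \<in> hol_weights l"
    using a b by (auto simp: hol_weights_def)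
  have c: "2 * l = of_int (- 2 - int j)" using j by auto
  show "tau_integral l (- n) (- m) (swap_indices Z) = tau_integral l n m Z"
    by (rule tau_integral_swap[OF a(1) b(1) c])
qed

lemma tau_hol:
  assumes "l \<in> spins" "m \<in> hol_weights l" "n \<in> hol_weights l"
  shows "Z$1$1 \<noteq> 0 \<Longrightarrow> \<exists>c. rational_value (tau_integral l n m) SU11 Z c"
    and "cmod (Z$2$1) < cmod (Z$1$1) \<Longrightarrow> tau l n m Z = tau_integral l n m Z"
proof -
  obtain k B C where fl: "\<lfloor>l - m\<rfloor> = - int (Suc k)" "\<lfloor>l + m\<rfloor> = int B" "\<lfloor>n - l\<rfloor> = int (Suc C)"
    using hol_floors[OF assms] .
  show "\<exists>c. rational_value (tau_integral l n m) SU11 Z c" if "Z$1$1 \<noteq> 0"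
    using rational_value_tau_sum[OF fl that] by blast
  show "tau l n m Z = tau_integral l n m Z" if "cmod (Z$2$1) < cmod (Z$1$1)"
  proof -
    have "Z$1$1 \<noteq> 0" using that by auto
    from tau_eqI[OF rational_value_tau_sum[OF fl this]] tau_integral_eq_sum[OF fl that]
    show ?thesis by simp
  qed
qed

lemma tau_antihol:
  assumes "l \<in> spins" "m \<in> antihol_weights l" "n \<in> antihol_weights l"
  shows "Z$2$2 \<noteq> 0 \<Longrightarrow> \<exists>c. rational_value (tau_integral l n m) SU11 Z c"
    and "cmod (Z$1$2) < cmod (Z$2$2) \<Longrightarrow> tau l n m Z = tau_integral l n m Z"
proof -
  note s = antihol_swap[OF assms]
  have eq: "(\<lambda>Z. tau_integral l (- n) (- m) (swap_indices Z)) = tau_integral l n m" by (rule ext) (rule s(3))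
  show *: "\<exists>c. rational_value (tau_integral l n m) SU11 Z c" if "Z$2$2 \<noteq> 0"
    using tau_hol(1)[OF assms(1) s(1,2), of "swap_indices Z"] that rational_value_swap[of _ Z] eq
    by fastforce
  obtain k B C where fl: "\<lfloor>l - - m\<rfloor> = - int (Suc k)" "\<lfloor>l + - m\<rfloor> = int B" "\<lfloor>- n - l\<rfloor> = int (Suc C)"
    using hol_floors[OF assms(1) s(1,2)] .
  show "tau l n m Z = tau_integral l n m Z" if "cmod (Z$1$2) < cmod (Z$2$2)"
  proof -
    have "rational_value (tau_integral l (- n) (- m)) SU11 (swap_indices Z) (tau_sum B C k (swap_indices Z))"
      by (rule rational_value_tau_sum[OF fl]) (use that in auto)
    from tau_eqI[OF rational_value_swap[OF this, unfolded eq]]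
    show ?thesis using tau_integral_eq_sum[OF fl, of "swap_indices Z"] that s(3)[of Z] by simp
  qed
qed


definition signature_form :: "complex^2 \<Rightarrow> real" where
  "signature_form v = (cmod (v$1))\<^sup>2 - (cmod (v$2))\<^sup>2"

lemma vmul_entry: "(v v* X)$j = v$1 * X$1$j + v$2 * (X::complex^2^2)$2$j"
  by (simp add: vector_matrix_mult_def sum_2 mult.commute)

lemma matrix_mul_entry: "(X ** Y)$i$j = X$i$1 * Y$1$j + X$i$2 * Y$2$j" for X Y :: "complex^2^2"
  by (simp add: matrix_matrix_mult_def sum_2)

lemma vmul_assoc: "v v* (X ** Y) = (v v* X) v* Y" for X Y :: "complex^2^2"
proof -
  have "(v v* (X ** Y))$j = ((v v* X) v* Y)$j" for j
    unfolding vmul_entry matrix_mul_entry by (simp add: algebra_simps)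
  then show ?thesis by (simp add: vec_eq_iff)
qed

lemma SU11_form: "g \<in> SU11 \<Longrightarrow> signature_form (v v* g) = signature_form v"
proof -
  assume g: "g \<in> SU11"
  define x y a b where "x = v$1" and "y = v$2" and "a = g$1$1" and "b = g$1$2"
  have g': "g$1$1 = a" "g$1$2 = b" "g$2$1 = cnj b" "g$2$2 = cnj a" "a * cnj a - b * cnj b = 1"
    using g by (auto simp: a_def b_def SU11_def det_2)
  have "complex_of_real (signature_form (v v* g)) =
     (x * a + y * cnj b) * cnj (x * a + y * cnj b) - (x * b + y * cnj a) * cnj (x * b + y * cnj a)"
    unfolding signature_form_def of_real_diff complex_norm_square
    by (simp add: vmul_entry g' x_def y_def)
  also have "\<dots> = (x * cnj x - y * cnj y) * (a * cnj a - b * cnj b)"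
    by (simp add: algebra_simps)
  also have "\<dots> = complex_of_real (signature_form v)"
    unfolding signature_form_def of_real_diff complex_norm_square g' by (simp add: x_def y_def)
  finally show ?thesis using of_real_eq_iff by blast
qed

lemma invertible_inv:
  assumes "det (X :: complex^2^2) \<noteq> 0"
  shows "X ** matrix_inv X = mat 1" "matrix_inv X ** X = mat 1"
proof -
  have "\<exists>Y. X ** Y = mat 1 \<and> Y ** X = mat 1"
    using assms invertible_det_nz[of X] by (simp add: invertible_def)
  from someI_ex[OF this] show "X ** matrix_inv X = mat 1" "matrix_inv X ** X = mat 1"
    unfolding matrix_inv_def by auto
qed

lemma SU11_inv_form: "g \<in> SU11 \<Longrightarrow> signature_form (v v* matrix_inv g) = signature_form v"
  using SU11_form[of g "v v* matrix_inv g"] invertible_inv(2)[of g]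
  by (simp add: SU11_def flip: vmul_assoc)

lemma vmul_nz: "det X \<noteq> 0 \<Longrightarrow> v \<noteq> 0 \<Longrightarrow> v v* (X::complex^2^2) \<noteq> 0"
  using invertible_inv(1)[of X] vmul_assoc[of v X "matrix_inv X"] by auto

lemma diag2_entry [simp]:
  "diag2 a b$1$1 = a" "diag2 a b$1$2 = 0" "diag2 a b$2$1 = 0" "diag2 a b$2$2 = b"
  by (simp_all add: diag2_def)

lemma diag2_form_pos:
  assumes "signature_form w \<ge> 0" "w \<noteq> 0" "cmod a > 1" "cmod b < 1"
  shows "signature_form (w v* diag2 a b) > 0"
proof -
  have le: "(cmod (w$2))\<^sup>2 \<le> (cmod (w$1))\<^sup>2" using assms(1) by (simp add: signature_form_def)
  have "w$1 \<noteq> 0"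
  proof
    assume "w$1 = 0"
    with le have "w$2 = 0" by simp
    with \<open>w$1 = 0\<close> have "w = 0" by (simp add: vec_eq_iff forall_2)
    with assms(2) show False by simp
  qed
  have a: "(cmod a)\<^sup>2 > 1" using assms(3) by (simp add: one_less_power)
  have b: "(cmod b)\<^sup>2 \<le> 1" using assms(4) by (simp add: power_le_one)
  have "(cmod (w$2))\<^sup>2 * (cmod b)\<^sup>2 \<le> (cmod (w$1))\<^sup>2 * 1"
    using le b by (intro mult_mono) auto
  also have "\<dots> < (cmod (w$1))\<^sup>2 * (cmod a)\<^sup>2"
    using a \<open>w$1 \<noteq> 0\<close> by (intro mult_strict_left_mono) auto
  finally show ?thesis by (simp add: signature_form_def vmul_entry norm_mult power_mult_distrib)
qed

lemma diag2_form_neg: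
  assumes "signature_form w \<le> 0" "w \<noteq> 0" "cmod b > 1" "cmod a < 1"
  shows "signature_form (w v* diag2 a b) < 0"
proof -
  have le: "(cmod (w$1))\<^sup>2 \<le> (cmod (w$2))\<^sup>2" using assms(1) by (simp add: signature_form_def)
  have "w$2 \<noteq> 0"
  proof
    assume "w$2 = 0"
    with le have "w$1 = 0" by simp
    with \<open>w$2 = 0\<close> have "w = 0" by (simp add: vec_eq_iff forall_2)
    with assms(2) show False by simp
  qed
  have b: "(cmod b)\<^sup>2 > 1" using assms(3) by (simp add: one_less_power)
  have a: "(cmod a)\<^sup>2 \<le> 1" using assms(4) by (simp add: power_le_one)
  have "(cmod (w$1))\<^sup>2 * (cmod a)\<^sup>2 \<le> (cmod (w$2))\<^sup>2 * 1"
    using le a by (intro mult_mono) auto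
  also have "\<dots> < (cmod (w$2))\<^sup>2 * (cmod b)\<^sup>2"
    using b \<open>w$2 \<noteq> 0\<close> by (intro mult_strict_left_mono) auto
  finally show ?thesis by (simp add: signature_form_def vmul_entry norm_mult power_mult_distrib)
qed

lemma Gamma_minus_form:
  assumes "X \<in> Gamma_minus" "v \<noteq> 0" "signature_form v \<ge> 0"
  shows "signature_form (v v* X) > 0"
proof -
  obtain g a b where g: "X = g ** diag2 a b ** matrix_inv g" "g \<in> SU11" "cmod a > 1" "cmod b < 1"
    using assms(1) by (auto simp: Gamma_minus_def)
  have "v v* g \<noteq> 0" by (rule vmul_nz) (use g(2) assms(2) in \<open>auto simp: SU11_def\<close>)
  then have "signature_form ((v v* g) v* diag2 a b) > 0"
    using diag2_form_pos g(3,4) SU11_form[OF g(2)] assms(3) by simp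
  then show ?thesis using SU11_inv_form[OF g(2)] by (simp add: g(1) vmul_assoc)
qed

lemma Gamma_plus_form:
  assumes "X \<in> Gamma_plus" "v \<noteq> 0" "signature_form v \<le> 0"
  shows "signature_form (v v* X) < 0"
proof -
  obtain g a b where g: "X = g ** diag2 a b ** matrix_inv g" "g \<in> SU11" "cmod b > 1" "cmod a < 1"
    using assms(1) by (auto simp: Gamma_plus_def)
  have "v v* g \<noteq> 0" by (rule vmul_nz) (use g(2) assms(2) in \<open>auto simp: SU11_def\<close>)
  then have "signature_form ((v v* g) v* diag2 a b) < 0"
    using diag2_form_neg g(3,4) SU11_form[OF g(2)] assms(3) by simp
  then show ?thesis using SU11_inv_form[OF g(2)] by (simp add: g(1) vmul_assoc)
qed

lemma maps_disc_shrink: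
  assumes "maps_disc i j X 1 1"
  obtains b where "0 < b" "b < 1" "maps_disc i j X 1 b"
proof -
  define r where "r t = cmod (X$i$j + X$j$j * t) / cmod (X$i$i + X$j$i * t)" for t
  have nz: "X$i$i + X$j$i * t \<noteq> 0" and lt: "r t < 1" if "cmod t \<le> 1" for t
  proof -
    have *: "cmod (X$i$j + X$j$j * t) < cmod (X$i$i + X$j$i * t)"
      using assms that by (auto simp: maps_disc_def)
    then have "0 < cmod (X$i$i + X$j$i * t)" using norm_ge_zero le_less_trans by blast
    then show "X$i$i + X$j$i * t \<noteq> 0" by auto
    show "r t < 1" using * \<open>0 < _\<close> by (simp add: r_def)
  qed
  have "continuous_on (cball 0 1) r"
    unfolding r_def by (intro continuous_intros) (use nz in auto)
  then obtain t0 where t0: "t0 \<in> cball 0 1" "\<And>t. t \<in> cball 0 1 \<Longrightarrow> r t \<le> r t0"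
    using continuous_attains_sup[of "cball 0 1" r] by auto
  have 0: "0 \<le> r t0" by (simp add: r_def)
  define b where "b = (r t0 + 1) / 2"
  have b: "0 < b" "b < 1" "r t0 < b" using 0 lt[of t0] t0(1) by (auto simp: b_def)
  have "maps_disc i j X 1 b"
    unfolding maps_disc_def
  proof (intro allI impI)
    fix t assume t: "cmod t \<le> 1"
    have "r t < b" using t0(2)[of t] t b(3) by auto
    then show "cmod (X$i$j + X$j$j * t) < b * cmod (X$i$i + X$j$i * t)"
      using nz[OF t] by (simp add: r_def divide_less_eq)
  qed
  with b that show thesis by blast
qed

lemma composable_minus:
  assumes g: "g \<in> SU11" and c: "c \<noteq> 0" and Z: "Z = (\<chi> i j. c * g$i$j)"
    and "W ** matrix_inv Z \<in> Gamma_minus"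
  shows "composable 1 2 W Z"
proof -
  have "det Z = c * c * det g" by (simp add: Z det_2 algebra_simps)
  then have dZ: "det Z \<noteq> 0" using g c by (simp add: SU11_def)
  have fZ: "signature_form (v v* Z) = (cmod c)\<^sup>2 * signature_form v" for v
  proof -
    have "signature_form (v v* Z) = (cmod c)\<^sup>2 * signature_form (v v* g)"
    proof -
      have "(v v* Z)$j = c * (v v* g)$j" for j by (simp add: vmul_entry Z algebra_simps)
      then show ?thesis by (simp add: signature_form_def norm_mult power_mult_distrib algebra_simps)
    qed
    then show ?thesis using SU11_form[OF g] by simp
  qed
  have W: "W = (W ** matrix_inv Z) ** Z"
    using invertible_inv(2)[OF dZ] by (simp flip: matrix_mul_assoc)
  have "maps_disc 1 2 W 1 1"
    unfolding maps_disc_def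
  proof (intro allI impI)
    fix t :: complex assume t: "cmod t \<le> 1"
    define v where "v = (vector [1, t] :: complex^2)"
    have v: "v$1 = 1" "v$2 = t" by (simp_all add: v_def)
    have "v \<noteq> 0" using v(1) by auto
    moreover have "signature_form v \<ge> 0" using t by (simp add: signature_form_def v power_le_one)
    ultimately have "signature_form (v v* (W ** matrix_inv Z)) > 0"
      by (rule Gamma_minus_form[OF assms(4)])
    then have "signature_form (v v* W) > 0"
      using c by (subst W) (simp add: vmul_assoc[of v "W ** matrix_inv Z" Z] fZ)
    then have "(cmod (W$1$2 + t * W$2$2))\<^sup>2 < (cmod (W$1$1 + t * W$2$1))\<^sup>2"
      by (simp add: signature_form_def vmul_entry v)
    then show "cmod (W$1$2 + W$2$2 * t) < 1 * cmod (W$1$1 + W$2$1 * t)"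
      by (simp add: mult.commute power_less_imp_less_base)
  qed
  then obtain b where b: "0 < b" "b < 1" "maps_disc 1 2 W 1 b" by (rule maps_disc_shrink)
  have "maps_disc 1 2 (matrix_inv Z) b 1"
    unfolding maps_disc_def
  proof (intro allI impI)
    fix t :: complex assume t: "cmod t \<le> b"
    define v where "v = (vector [1, t] :: complex^2)"
    have v: "v$1 = 1" "v$2 = t" by (simp_all add: v_def)
    have "(cmod t)\<^sup>2 < 1" using t b(2) by (simp add: power_less_one_iff)
    then have "signature_form v > 0" by (simp add: signature_form_def v)
    moreover have "signature_form v = (cmod c)\<^sup>2 * signature_form (v v* matrix_inv Z)"
      unfolding fZ[symmetric] using invertible_inv(2)[OF dZ] by (simp flip: vmul_assoc)
    ultimately have "signature_form (v v* matrix_inv Z) > 0" using c by (simp add: zero_less_mult_iff)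
    then have "(cmod (matrix_inv Z$1$2 + t * matrix_inv Z$2$2))\<^sup>2 < (cmod (matrix_inv Z$1$1 + t * matrix_inv Z$2$1))\<^sup>2"
      by (simp add: signature_form_def vmul_entry v)
    then show "cmod (matrix_inv Z$1$2 + matrix_inv Z$2$2 * t) < 1 * cmod (matrix_inv Z$1$1 + matrix_inv Z$2$1 * t)"
      by (simp add: mult.commute power_less_imp_less_base)
  qed
  with b show ?thesis unfolding composable_def by (intro exI[of _ 1] conjI exI[of _ b]) auto
qed

lemma composable_plus:
  assumes g: "g \<in> SU11" and c: "c \<noteq> 0" and Z: "Z = (\<chi> i j. c * g$i$j)"
    and "W ** matrix_inv Z \<in> Gamma_plus"
  shows "composable 2 1 W Z"
proof -
  have "det Z = c * c * det g" by (simp add: Z det_2 algebra_simps)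
  then have dZ: "det Z \<noteq> 0" using g c by (simp add: SU11_def)
  have fZ: "signature_form (v v* Z) = (cmod c)\<^sup>2 * signature_form v" for v
  proof -
    have "signature_form (v v* Z) = (cmod c)\<^sup>2 * signature_form (v v* g)"
    proof -
      have "(v v* Z)$j = c * (v v* g)$j" for j by (simp add: vmul_entry Z algebra_simps)
      then show ?thesis by (simp add: signature_form_def norm_mult power_mult_distrib algebra_simps)
    qed
    then show ?thesis using SU11_form[OF g] by simp
  qed
  have W: "W = (W ** matrix_inv Z) ** Z"
    using invertible_inv(2)[OF dZ] by (simp flip: matrix_mul_assoc)
  have "maps_disc 2 1 W 1 1"
    unfolding maps_disc_def
  proof (intro allI impI)
    fix t :: complex assume t: "cmod t \<le> 1"
    define v where "v = (vector [t, 1] :: complex^2)"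
    have v: "v$1 = t" "v$2 = 1" by (simp_all add: v_def)
    have "v \<noteq> 0" using v(2) by auto
    moreover have "signature_form v \<le> 0" using t by (simp add: signature_form_def v power_le_one)
    ultimately have "signature_form (v v* (W ** matrix_inv Z)) < 0"
      by (rule Gamma_plus_form[OF assms(4)])
    then have "signature_form (v v* W) < 0"
      using c by (subst W) (simp add: vmul_assoc[of v "W ** matrix_inv Z" Z] fZ mult_less_0_iff)
    then have "(cmod (t * W$1$1 + W$2$1))\<^sup>2 < (cmod (t * W$1$2 + W$2$2))\<^sup>2"
      by (simp add: signature_form_def vmul_entry v)
    then show "cmod (W$2$1 + W$1$1 * t) < 1 * cmod (W$2$2 + W$1$2 * t)"
      by (simp add: mult.commute add.commute power_less_imp_less_base)
  qed
  then obtain b where b: "0 < b" "b < 1" "maps_disc 2 1 W 1 b" by (rule maps_disc_shrink)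
  have "maps_disc 2 1 (matrix_inv Z) b 1"
    unfolding maps_disc_def
  proof (intro allI impI)
    fix t :: complex assume t: "cmod t \<le> b"
    define v where "v = (vector [t, 1] :: complex^2)"
    have v: "v$1 = t" "v$2 = 1" by (simp_all add: v_def)
    have "(cmod t)\<^sup>2 < 1" using t b(2) by (simp add: power_less_one_iff)
    then have "signature_form v < 0" by (simp add: signature_form_def v)
    moreover have "signature_form v = (cmod c)\<^sup>2 * signature_form (v v* matrix_inv Z)"
      unfolding fZ[symmetric] using invertible_inv(2)[OF dZ] by (simp flip: vmul_assoc)
    ultimately have "signature_form (v v* matrix_inv Z) < 0" using c by (simp add: mult_less_0_iff)
    then have "(cmod (t * matrix_inv Z$1$1 + matrix_inv Z$2$1))\<^sup>2 < (cmod (t * matrix_inv Z$1$2 + matrix_inv Z$2$2))\<^sup>2"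
      by (simp add: signature_form_def vmul_entry v)
    then show "cmod (matrix_inv Z$2$1 + matrix_inv Z$1$1 * t) < 1 * cmod (matrix_inv Z$2$2 + matrix_inv Z$1$2 * t)"
      by (simp add: mult.commute add.commute power_less_imp_less_base)
  qed
  with b show ?thesis unfolding composable_def by (intro exI[of _ 1] conjI exI[of _ b]) auto
qed

end

theory Submission
  imports Defs
begin

text \<open>
  Let \<open>q = -2l\<close>, \<open>i = l + m\<close>, \<open>j = l + n\<close>. The substitution \<open>t = 1/s\<close> shows that the matrix coefficient
  at \<open>Y\<close> is the coefficient of \<open>t\<^sup>j\<close> in \<open>den(t)\<close> to the power \<open>-q\<close> times the \<open>i\<close>-th power of
  the Moebius map \<open>t \<mapsto> num(t)/den(t)\<close> of \<open>Y\<close>. Rescaling the rows and columns of \<open>W\<close> and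
  \<open>V = Z\<^sup>-\<^sup>1\<close> turns both discs of the composability hypothesis into the unit disc. The sum over \<open>m\<close> then composes
  the two Moebius maps, and the sum over \<open>n\<close> is a geometric series under the integral, equal to
  the integral of \<open>den(t)\<close> to the power \<open>-q\<close> over \<open>t - \<phi>(t)\<close>, where \<open>den\<close> and \<open>\<phi>\<close> now belong to \<open>W V\<close>.
  The only pole in the disc is the attracting fixed point of \<open>\<phi>\<close>, which is the eigenvector for
  \<open>\<lambda>\<^sub>1\<close>, and Cauchy's formula gives the character \<open>1 / (\<lambda>\<^sub>1\<^sup>p (\<lambda>\<^sub>1 - \<lambda>\<^sub>2))\<close>
  with \<open>p = q - 1 = -(2l + 1)\<close>. The sums over \<open>k\<close> and \<open>l\<close> are geometric and differentiated geometric series.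
  Exchanging the two indices of all matrices gives the antiholomorphic case.
\<close>

section \<open>Coefficients as integrals over the unit circle\<close>

text \<open>The Weierstrass M-test makes the partial sums converge uniformly on the circle, so sum
  and integral may be exchanged. The expansions of this section are integrated termwise by this
  rule.\<close>

lemma contour_integral_sums_circlepath:
  fixes f :: "nat \<Rightarrow> complex \<Rightarrow> complex"
  assumes "\<And>n. continuous_on (sphere 0 1) (f n)"
    and bd: "\<And>n t. t \<in> sphere 0 1 \<Longrightarrow> norm (f n t) \<le> M n" and "summable M"
    and S: "\<And>t. t \<in> sphere 0 1 \<Longrightarrow> (\<lambda>n. f n t) sums S t"
  shows "(\<lambda>n. contour_integral (circlepath 0 1) (f n)) sums contour_integral (circlepath 0 1) S"
proof -
  have int: "f n contour_integrable_on circlepath 0 1" for n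
    by (rule contour_integrable_continuous_circlepath) (use assms(1)[of n] in simp)
  have "uniform_limit (sphere 0 1) (\<lambda>N t. \<Sum>n<N. f n t) (\<lambda>t. \<Sum>n. f n t) sequentially"
    by (rule Weierstrass_m_test) (use assms in auto)
  then have "uniform_limit (sphere 0 1) (\<lambda>N t. \<Sum>n<N. f n t) S sequentially"
    by (rule uniform_limit_cong'[THEN iffD1, rotated -1]) (use S in \<open>auto simp: sums_iff\<close>)
  then have "(\<lambda>N. contour_integral (circlepath 0 1) (\<lambda>t. \<Sum>n<N. f n t)) \<longlonglongrightarrow> contour_integral (circlepath 0 1) S"
    by (intro contour_integral_uniform_limit_circlepath)
       (auto intro!: always_eventually contour_integrable_sum int)
  then show ?thesis
    by (simp add: sums_def contour_integral_sum int)
qed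

lemma continuous_on_circle_bounded:
  fixes F :: "complex \<Rightarrow> complex"
  assumes "continuous_on (sphere 0 1) F"
  shows "\<exists>B. \<forall>t\<in>sphere 0 1. norm (F t) \<le> B"
  using compact_imp_bounded[OF compact_continuous_image[OF assms compact_sphere]]
  unfolding bounded_iff by auto

text \<open>The \<open>j\<close>-th Fourier coefficient of \<open>F\<close> on the unit circle. If
  \<open>F\<close> is continuous on the closed disc and holomorphic inside, it is the Taylor
  coefficient, by \<open>circle_coeff_sums\<close>.\<close>

definition circle_coeff :: "(complex \<Rightarrow> complex) \<Rightarrow> nat \<Rightarrow> complex" where
  "circle_coeff F j = contour_integral (circlepath 0 1) (\<lambda>t. F t / t ^ Suc j) / (2 * of_real pi * \<i>)"

lemma norm_circle_coeff_le:
  assumes "continuous_on (sphere 0 1) F" "\<And>t. t \<in> sphere 0 1 \<Longrightarrow> norm (F t) \<le> M"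
  shows "norm (circle_coeff F j) \<le> M"
proof -
  \<comment> \<open>The bound at one point of the circle shows that \<open>M\<close> is nonnegative,
    as the estimate of the integral requires.\<close>
  have "norm (F 1) \<le> M" by (rule assms(2)) simp
  then have M: "M \<ge> 0" using norm_ge_zero order_trans by blast
  have "(\<lambda>t. F t / t ^ Suc j) contour_integrable_on circlepath 0 1"
    by (rule contour_integrable_continuous_circlepath) (auto intro!: continuous_intros assms(1))
  then have "norm (contour_integral (circlepath 0 1) (\<lambda>t. F t / t ^ Suc j)) \<le> M * (2 * pi * 1)"
    by (intro has_contour_integral_bound_circlepath[OF has_contour_integral_integral])
       (use M assms(2) in \<open>auto simp: norm_divide norm_mult norm_power\<close>)
  then show ?thesis by (simp add: circle_coeff_def norm_divide norm_mult field_simps)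
qed

lemma circle_coeff_cong:
  assumes "\<And>t. t \<in> sphere 0 1 \<Longrightarrow> F t = G t"
  shows "circle_coeff F j = circle_coeff G j"
  unfolding circle_coeff_def
  by (intro arg_cong[of _ _ "\<lambda>x. x / _"] contour_integral_eq) (use assms in simp)

lemma Cauchy_integral_circlepath_unit:
  assumes "continuous_on (cball 0 1) F" "F holomorphic_on ball 0 1" "w \<in> ball 0 1"
  shows "contour_integral (circlepath 0 1) (\<lambda>t. F t / (t - w)) / (2 * of_real pi * \<i>) = F w"
  using contour_integral_unique[OF Cauchy_integral_circlepath[OF assms(1,2), of w]] assms(3)
  by (simp add: dist_norm norm_minus_commute)

text \<open>On the circle the Cauchy kernel \<open>1 / (t - w)\<close> is a geometric series in
  \<open>w / t\<close>, uniformly convergent since \<open>w\<close> lies in the open disc.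
  Integrating it termwise against \<open>F\<close> and applying Cauchy's formula gives the
  claim.\<close>

lemma circle_coeff_sums:
  assumes c: "continuous_on (cball 0 1) F" and h: "F holomorphic_on ball 0 1" and w: "w \<in> ball 0 1"
  shows "(\<lambda>j. circle_coeff F j * w ^ j) sums F w"
proof -
  have cs: "continuous_on (sphere 0 1) F" using c by (rule continuous_on_subset) auto
  obtain B where B: "\<And>t. t \<in> sphere 0 1 \<Longrightarrow> norm (F t) \<le> B"
    using continuous_on_circle_bounded[OF cs] by blast
  have "(\<lambda>j. contour_integral (circlepath 0 1) (\<lambda>t. w ^ j * (F t / t ^ Suc j))) sums
      contour_integral (circlepath 0 1) (\<lambda>t. F t / (t - w))"
  proof (rule contour_integral_sums_circlepath[where M = "\<lambda>j. B * norm w ^ j"])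
    show "continuous_on (sphere 0 1) (\<lambda>t. w ^ j * (F t / t ^ Suc j))" for j
      by (auto intro!: continuous_intros cs)
    show "norm (w ^ j * (F t / t ^ Suc j)) \<le> B * norm w ^ j" if "t \<in> sphere 0 1" for t j
      using B[OF that] that by (simp add: norm_mult norm_divide norm_power mult.commute mult_right_mono)
    show "summable (\<lambda>j. B * norm w ^ j)" using w by (intro summable_mult summable_geometric) simp
    show "(\<lambda>j. w ^ j * (F t / t ^ Suc j)) sums (F t / (t - w))" if "t \<in> sphere 0 1" for t
    proof -
      have t: "t \<noteq> 0" "t \<noteq> w" "norm (w / t) < 1" using that w by (auto simp: norm_divide)
      have "(\<lambda>j. (F t / t) * (w / t) ^ j) sums ((F t / t) * (1 / (1 - w / t)))"
        by (intro sums_mult geometric_sums t)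
      also have "(F t / t) * (1 / (1 - w / t)) = F t / (t - w)" using t by (simp add: field_simps)
      finally show ?thesis by (simp add: power_divide mult.commute)
    qed
  qed
  from sums_divide[OF this, of "2 * of_real pi * \<i>"]
  have "(\<lambda>j. contour_integral (circlepath 0 1) (\<lambda>t. w ^ j * (F t / t ^ Suc j)) / (2 * of_real pi * \<i>)) sums F w"
    unfolding Cauchy_integral_circlepath_unit[OF assms] .
  moreover have "contour_integral (circlepath 0 1) (\<lambda>t. w ^ j * (F t / t ^ Suc j)) / (2 * of_real pi * \<i>)
      = circle_coeff F j * w ^ j" for j
  proof -
    have "(\<lambda>t. F t / t ^ Suc j) contour_integrable_on circlepath 0 1"
      by (rule contour_integrable_continuous_circlepath) (auto intro!: continuous_intros cs)
    from contour_integral_lmul[OF this] show ?thesis by (simp add: circle_coeff_def)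
  qed
  ultimately show ?thesis by simp
qed

text \<open>Expand \<open>G\<close> in its Taylor series at the point \<open>\<phi> t\<close>. The
  coefficients of \<open>G\<close> are bounded and \<open>\<phi>\<close> stays within radius
  \<open>r\<close>, so the terms have the summable majorant \<open>C * B * r ^ i\<close>.\<close>

lemma circle_coeff_compose_sums:
  assumes F: "continuous_on (sphere 0 1) F" and ph: "continuous_on (sphere 0 1) \<phi>"
    and r: "r < 1" "\<And>t. t \<in> sphere 0 1 \<Longrightarrow> norm (\<phi> t) \<le> r"
    and G: "continuous_on (cball 0 1) G" "G holomorphic_on ball 0 1"
  shows "(\<lambda>i. circle_coeff (\<lambda>t. F t * \<phi> t ^ i) j * circle_coeff G i) sums circle_coeff (\<lambda>t. F t * G (\<phi> t)) j"
proof -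
  have cG: "continuous_on (sphere 0 1) G" using G(1) by (rule continuous_on_subset) auto
  obtain B where B: "\<And>t. t \<in> sphere 0 1 \<Longrightarrow> norm (F t) \<le> B"
    using continuous_on_circle_bounded[OF F] by blast
  obtain C where C: "\<And>t. t \<in> sphere 0 1 \<Longrightarrow> norm (G t) \<le> C"
    using continuous_on_circle_bounded[OF cG] by blast
  have C': "norm (circle_coeff G i) \<le> C" for i by (rule norm_circle_coeff_le[OF cG C])
  have "norm (F 1) \<le> B" "norm (\<phi> 1) \<le> r" by (rule B r; simp)+
  then have B0: "B \<ge> 0" "r \<ge> 0" using norm_ge_zero order_trans by blast+
  have "(\<lambda>i. contour_integral (circlepath 0 1) (\<lambda>t. circle_coeff G i * (F t * \<phi> t ^ i / t ^ Suc j))) sums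
      contour_integral (circlepath 0 1) (\<lambda>t. F t * G (\<phi> t) / t ^ Suc j)"
  proof (rule contour_integral_sums_circlepath[where M = "\<lambda>i. C * B * r ^ i"])
    show "continuous_on (sphere 0 1) (\<lambda>t. circle_coeff G i * (F t * \<phi> t ^ i / t ^ Suc j))" for i
      by (auto intro!: continuous_intros F ph)
    show "norm (circle_coeff G i * (F t * \<phi> t ^ i / t ^ Suc j)) \<le> C * B * r ^ i" if "t \<in> sphere 0 1" for t i
    proof -
      have "norm (circle_coeff G i * (F t * \<phi> t ^ i / t ^ Suc j)) = norm (circle_coeff G i) * (norm (F t) * norm (\<phi> t) ^ i)"
        using that by (simp add: norm_mult norm_divide norm_power)
      also have "\<dots> \<le> C * (B * r ^ i)"
        using B0 C'[of i] B[OF that] r(2)[OF that] norm_ge_zero[of "circle_coeff G i"]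
        by (intro mult_mono power_mono) (auto intro: order_trans[OF norm_ge_zero])
      finally show ?thesis by simp
    qed
    show "summable (\<lambda>i. C * B * r ^ i)" using r(1) B0 by (intro summable_mult summable_geometric) simp
    show "(\<lambda>i. circle_coeff G i * (F t * \<phi> t ^ i / t ^ Suc j)) sums (F t * G (\<phi> t) / t ^ Suc j)" if "t \<in> sphere 0 1" for t
    proof -
      have "\<phi> t \<in> ball 0 1" using r that by fastforce
      from sums_mult[OF circle_coeff_sums[OF G this], of "F t / t ^ Suc j"]
      show ?thesis by (simp add: mult_ac)
    qed
  qed
  then have "(\<lambda>i. contour_integral (circlepath 0 1) (\<lambda>t. circle_coeff G i * (F t * \<phi> t ^ i / t ^ Suc j)) / (2 * of_real pi * \<i>))
      sums circle_coeff (\<lambda>t. F t * G (\<phi> t)) j"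
    unfolding circle_coeff_def by (rule sums_divide)
  moreover have "contour_integral (circlepath 0 1) (\<lambda>t. circle_coeff G i * (F t * \<phi> t ^ i / t ^ Suc j)) / (2 * of_real pi * \<i>)
      = circle_coeff (\<lambda>t. F t * \<phi> t ^ i) j * circle_coeff G i" for i
  proof -
    have "(\<lambda>t. F t * \<phi> t ^ i / t ^ Suc j) contour_integrable_on circlepath 0 1"
      by (rule contour_integrable_continuous_circlepath) (auto intro!: continuous_intros F ph)
    from contour_integral_lmul[OF this]
    show ?thesis by (simp add: circle_coeff_def[of "\<lambda>t. F t * \<phi> t ^ i"])
  qed
  ultimately show ?thesis by simp
qed

text \<open>In the basis of monomials the left-hand side is the sum of the diagonal entries of the
  operator taking \<open>f\<close> to \<open>F\<close> times \<open>f\<close> composed with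
  \<open>\<phi>\<close>. Under the integral it becomes a geometric series with ratio
  \<open>\<phi> t / t\<close>, of modulus at most \<open>r\<close> on the circle.\<close>

lemma circle_coeff_diagonal_sums:
  assumes F: "continuous_on (sphere 0 1) F" and ph: "continuous_on (sphere 0 1) \<phi>"
    and r: "r < 1" "\<And>t. t \<in> sphere 0 1 \<Longrightarrow> norm (\<phi> t) \<le> r"
  shows "(\<lambda>j. circle_coeff (\<lambda>t. F t * \<phi> t ^ j) j) sums
    (contour_integral (circlepath 0 1) (\<lambda>t. F t / (t - \<phi> t)) / (2 * of_real pi * \<i>))"
proof -
  obtain B where B: "\<And>t. t \<in> sphere 0 1 \<Longrightarrow> norm (F t) \<le> B"
    using continuous_on_circle_bounded[OF F] by blast
  have "norm (F 1) \<le> B" "norm (\<phi> 1) \<le> r" by (rule B r; simp)+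
  then have B0: "B \<ge> 0" "r \<ge> 0" using norm_ge_zero order_trans by blast+
  show ?thesis unfolding circle_coeff_def
  proof (rule sums_divide, rule contour_integral_sums_circlepath[where M = "\<lambda>j. B * r ^ j"])
  show "continuous_on (sphere 0 1) (\<lambda>t. F t * \<phi> t ^ j / t ^ Suc j)" for j
    by (auto intro!: continuous_intros F ph)
  show "norm (F t * \<phi> t ^ j / t ^ Suc j) \<le> B * r ^ j" if "t \<in> sphere 0 1" for t j
    using that B[OF that] r(2)[OF that] B0
    by (simp add: norm_mult norm_divide norm_power mult_mono power_mono)
  show "summable (\<lambda>j. B * r ^ j)" using r(1) B0 by (intro summable_mult summable_geometric) simp
  show "(\<lambda>j. F t * \<phi> t ^ j / t ^ Suc j) sums (F t / (t - \<phi> t))" if "t \<in> sphere 0 1" for t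
  proof -
    have "norm (\<phi> t) < 1" using r that by fastforce
    then have t: "t \<noteq> 0" "t \<noteq> \<phi> t" "norm (\<phi> t / t) < 1" using that by (auto simp: norm_divide)
    have "(\<lambda>j. (F t / t) * (\<phi> t / t) ^ j) sums ((F t / t) * (1 / (1 - \<phi> t / t)))"
      by (intro sums_mult geometric_sums t)
    also have "(F t / t) * (1 / (1 - \<phi> t / t)) = F t / (t - \<phi> t)" using t by (simp add: field_simps)
    finally show ?thesis by (simp add: power_divide)
  qed
qed
qed

text \<open>The substitution s = 1/t gives ds = - dt/t^2 and also reverses the orientation of the
  circle, so the two signs cancel. In the parametrization it is the reflection of \<open>x\<close>
  to \<open>1 - x\<close>.\<close>

lemma contour_integral_circlepath_inverse:
  "contour_integral (circlepath 0 1) f = contour_integral (circlepath 0 1) (\<lambda>t. f (1 / t) / t\<^sup>2)"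
proof -
  define e where "e x = exp (2 * of_real pi * \<i> * of_real x)" for x :: real
  have I: "contour_integral (circlepath 0 1) h = integral {0..1} (\<lambda>x. h (e x) * (2 * pi * \<i> * e x))" for h
    unfolding contour_integral_integral vector_derivative_circlepath e_def
    by (simp add: circlepath algebra_simps)
  have e: "e (1 - x) = 1 / e x" "e x \<noteq> 0" for x by (simp_all add: e_def algebra_simps exp_diff)
  have "integral {0..1} (\<lambda>x. f (e x) * (2 * pi * \<i> * e x))
      = integral {0..1} (\<lambda>x. f (1 / e x) * (2 * pi * \<i> * (1 / e x)))"
    using integral_reflect_01[of "\<lambda>x. f (e x) * (2 * pi * \<i> * e x)"] by (simp only: e)
  also have "\<dots> = integral {0..1} (\<lambda>x. f (1 / e x) / (e x)\<^sup>2 * (2 * pi * \<i> * e x))"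
    using e(2) by (intro integral_cong) (simp add: power2_eq_square)
  finally show ?thesis unfolding I .
qed

text \<open>The row vector \<open>(1, t)\<close> times \<open>Y\<close> is
  \<open>(den Y t, num Y t)\<close>, and the Moebius map of \<open>Y\<close> sends \<open>t\<close>
  to \<open>num Y t / den Y t\<close>. Since rows are multiplied from the right,
  \<open>W ** V\<close> applies \<open>W\<close> first.\<close>

definition num :: "complex^2^2 \<Rightarrow> complex \<Rightarrow> complex" where "num Y t = Y$1$2 + Y$2$2 * t"
definition den :: "complex^2^2 \<Rightarrow> complex \<Rightarrow> complex" where "den Y t = Y$1$1 + Y$2$1 * t"

lemma tau_integral_eq_circle_coeff:
  assumes fl: "\<lfloor>l - m\<rfloor> = - int (i + q)" "\<lfloor>l + m\<rfloor> = int i" "\<lfloor>n - l\<rfloor> = int (j + q)" and q: "q \<ge> 1"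
  shows "tau_integral l n m Y = circle_coeff (\<lambda>t. num Y t ^ i / den Y t ^ (i + q)) j"
proof -
  have "contour_integral (circlepath 0 1)
       (\<lambda>s. (s * Y$1$1 + Y$2$1) powi \<lfloor>l - m\<rfloor> * (s * Y$1$2 + Y$2$2) powi \<lfloor>l + m\<rfloor>
            * s powi \<lfloor>n - l\<rfloor> / s) =
      contour_integral (circlepath 0 1) (\<lambda>t. num Y t ^ i / den Y t ^ (i + q) / t ^ Suc j)"
  proof (subst contour_integral_circlepath_inverse, rule contour_integral_eq)
    fix t :: complex assume "t \<in> path_image (circlepath 0 1)"
    then have t: "t \<noteq> 0" by auto
    have a: "1 / t * Y$1$1 + Y$2$1 = den Y t / t" "1 / t * Y$1$2 + Y$2$2 = num Y t / t"
      using t by (simp_all add: den_def num_def field_simps)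
    \<comment> \<open>The exponents of \<open>t\<close> add up to
      \<open>(i + q) - i - (j + q) + 1 - 2 = - (j + 1)\<close>.\<close>
    show "((1 / t * Y$1$1 + Y$2$1) powi \<lfloor>l - m\<rfloor> * (1 / t * Y$1$2 + Y$2$2) powi \<lfloor>l + m\<rfloor>
            * (1 / t) powi \<lfloor>n - l\<rfloor> / (1 / t)) / t\<^sup>2 = num Y t ^ i / den Y t ^ (i + q) / t ^ Suc j"
      unfolding a fl power_int_minus power_int_of_nat power_divide using t
      by (simp add: power_add field_simps power2_eq_square)
  qed
  then show ?thesis by (simp only: tau_integral_def circle_coeff_def)
qed

section \<open>The trace of a composition of Moebius maps\<close>

lemma maps_disc_1_2_iff: "maps_disc 1 2 Y a b \<longleftrightarrow> (\<forall>t. cmod t \<le> a \<longrightarrow> cmod (num Y t) < b * cmod (den Y t))"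
  by (simp add: maps_disc_def num_def den_def)

lemma maps_disc_den_nonzero: "maps_disc 1 2 Y a b \<Longrightarrow> cmod t \<le> a \<Longrightarrow> den Y t \<noteq> 0"
  unfolding maps_disc_1_2_iff by force

lemma continuous_on_num [continuous_intros]: "continuous_on S (num Y)"
  unfolding num_def by (intro continuous_intros)

lemma continuous_on_den [continuous_intros]: "continuous_on S (den Y)"
  unfolding den_def by (intro continuous_intros)

lemma holomorphic_on_num [holomorphic_intros]: "num Y holomorphic_on S"
  unfolding num_def by (intro holomorphic_intros)

lemma holomorphic_on_den [holomorphic_intros]: "den Y holomorphic_on S"
  unfolding den_def by (intro holomorphic_intros)

text \<open>The row \<open>(1, t)\<close> times \<open>W\<close> equals \<open>den W t\<close> times
  \<open>(1, num W t / den W t)\<close>, on which \<open>V\<close> then acts. Thus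
  \<open>den\<close> is the automorphy factor of the composition.\<close>

lemma num_den_matrix_mul:
  assumes "den W t \<noteq> 0"
  shows "num (W ** V) t = den W t * num V (num W t / den W t)"
    "den (W ** V) t = den W t * den V (num W t / den W t)"
  using assms unfolding num_def[of V] den_def[of V]
  by (simp_all add: ring_distribs) (simp_all add: num_def den_def matrix_mul_entry algebra_simps)

lemma maps_disc_matrix_mul:
  assumes W: "maps_disc 1 2 W a b" and V: "maps_disc 1 2 V b c"
  shows "maps_disc 1 2 (W ** V) a c"
  unfolding maps_disc_1_2_iff
proof (intro allI impI)
  fix t assume t: "cmod t \<le> a"
  note nz = maps_disc_den_nonzero[OF W t]
  have "cmod (num W t / den W t) \<le> b"
    using W t nz unfolding maps_disc_1_2_iff by (simp add: norm_divide divide_le_eq less_imp_le)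
  then have "cmod (num V (num W t / den W t)) < c * cmod (den V (num W t / den W t))"
    using V unfolding maps_disc_1_2_iff by blast
  then show "cmod (num (W ** V) t) < c * cmod (den (W ** V) t)"
    using nz by (simp add: num_den_matrix_mul norm_mult mult.left_commute)
qed

text \<open>The coefficient of \<open>t ^ j\<close> in the image of the \<open>i\<close>-th monomial
  under the weighted composition operator that composes with the Moebius map of \<open>Y\<close> and
  divides by \<open>den Y t ^ q\<close>.\<close>

definition moebius_coeff :: "complex^2^2 \<Rightarrow> nat \<Rightarrow> nat \<Rightarrow> nat \<Rightarrow> complex" where
  "moebius_coeff Y q i j = circle_coeff (\<lambda>t. num Y t ^ i / den Y t ^ (i + q)) j"

text \<open>By \<open>maps_disc_shrink\<close> the Moebius map has modulus at most some
  \<open>r < 1\<close> on the circle, which gives geometric decay in \<open>i\<close>, uniformly in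
  \<open>j\<close>. A coefficient of \<open>W\<close> times the transposed one of \<open>V\<close>
  then decays in both indices.\<close>

lemma moebius_coeff_bound:
  assumes "maps_disc 1 2 Y 1 1"
  obtains B r where "0 \<le> r" "r < 1" "\<And>i j. norm (moebius_coeff Y q i j) \<le> B * r ^ i"
proof -
  from assms obtain r where r: "0 < r" "r < 1" "maps_disc 1 2 Y 1 r"
    by (rule maps_disc_shrink)
  have nz: "den Y t \<noteq> 0" if "t \<in> sphere 0 1" for t
    using maps_disc_den_nonzero[OF assms] that by simp
  have "continuous_on (sphere 0 1) (\<lambda>t. 1 / den Y t ^ q)"
    using nz by (intro continuous_intros) auto
  from continuous_on_circle_bounded[OF this]
  obtain B where B: "\<And>t. t \<in> sphere 0 1 \<Longrightarrow> norm (1 / den Y t ^ q) \<le> B" by blast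
  have "norm (moebius_coeff Y q i j) \<le> B * r ^ i" for i j
    unfolding moebius_coeff_def
  proof (rule norm_circle_coeff_le)
    show "continuous_on (sphere 0 1) (\<lambda>t. num Y t ^ i / den Y t ^ (i + q))"
      using nz by (intro continuous_intros) auto
    fix t :: complex assume t: "t \<in> sphere 0 1"
    have "norm (num Y t / den Y t) \<le> r"
      using r(3) t nz[OF t] unfolding maps_disc_1_2_iff
      by (simp add: norm_divide divide_le_eq less_imp_le)
    then have "norm (1 / den Y t ^ q) * norm (num Y t / den Y t) ^ i \<le> B * r ^ i"
      using B[OF t] r by (intro mult_mono power_mono) (auto intro: order_trans[OF norm_ge_zero])
    then show "norm (num Y t ^ i / den Y t ^ (i + q)) \<le> B * r ^ i"
      by (simp add: norm_divide norm_mult norm_power power_add power_divide mult.commute)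
  qed
  with r show thesis by (intro that[of r B]) auto
qed

lemma summable_on_geometric_product:
  fixes r s C :: real
  assumes "0 \<le> r" "r < 1" "0 \<le> s" "s < 1" "0 \<le> C"
  shows "(\<lambda>(i, j). C * r ^ i * s ^ j) summable_on (UNIV \<times> UNIV)"
proof (rule summable_on_SigmaI)
  show "((\<lambda>j. case (i, j) of (i, j) \<Rightarrow> C * r ^ i * s ^ j) has_sum C * r ^ i * (1 / (1 - s))) UNIV" for i
    using assms unfolding prod.case
    by (intro has_sum_cmult_right norm_summable_imp_has_sum geometric_sums)
       (simp_all add: summable_geometric)
  show "(\<lambda>i. C * r ^ i * (1 / (1 - s))) summable_on UNIV"
    using assms by (intro summable_on_cmult_left summable_on_cmult_right norm_summable_imp_summable_on)
       (simp_all add: summable_geometric)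
qed (use assms in auto)

text \<open>A fixed-point formula for the trace. The fixed point \<open>t0\<close> in the open disc
  has eigenvalue \<open>a\<close>; the trace makes \<open>b\<close> the other eigenvalue, and the
  hypothesis \<open>b\<close> keeps its fixed point out of the closed disc. The integral for the
  trace then has \<open>t0\<close> as its only pole inside. The value is the geometric series in
  \<open>b / a\<close> with first term \<open>1 / a ^ Suc p\<close>.\<close>

lemma moebius_coeff_trace:
  assumes W: "maps_disc 1 2 W 1 1" and V: "maps_disc 1 2 V 1 1"
    and t0: "cmod t0 < 1" "den (W ** V) t0 = a" "num (W ** V) t0 = a * t0"
    and b: "\<And>t. cmod t \<le> 1 \<Longrightarrow> den (W ** V) t = b \<Longrightarrow> num (W ** V) t = b * t \<Longrightarrow> False"
    and tr: "(W ** V)$1$1 + (W ** V)$2$2 = a + b"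
  shows "((\<lambda>(i, j). moebius_coeff W (Suc p) i j * moebius_coeff V (Suc p) j i) has_sum
      1 / (a ^ p * (a - b))) UNIV"
proof -
  define X where "X = W ** V"
  define q where "q = Suc p"
  note X = maps_disc_matrix_mul[OF W V, folded X_def]
  note tX = t0(2,3)[folded X_def] and trX = tr[folded X_def]
  obtain BW rW where BW: "0 \<le> rW" "rW < 1" "\<And>i j. norm (moebius_coeff W q i j) \<le> BW * rW ^ i"
    using moebius_coeff_bound[OF W] by metis
  obtain BV rV where BV: "0 \<le> rV" "rV < 1" "\<And>i j. norm (moebius_coeff V q i j) \<le> BV * rV ^ i"
    using moebius_coeff_bound[OF V] by metis
  define f where "f = (\<lambda>(i, j). moebius_coeff W q i j * moebius_coeff V q j i)"
  have "BW \<ge> 0" "BV \<ge> 0" using BW(3)[of 0 0] BV(3)[of 0 0] by (auto intro: order_trans[OF norm_ge_zero])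
  have "(\<lambda>x. norm (f x)) summable_on UNIV \<times> UNIV"
  proof (rule Infinite_Sum.abs_summable_on_comparison_test')
    show "(\<lambda>(i, j). (BW * BV) * rW ^ i * rV ^ j) summable_on UNIV \<times> UNIV"
      by (rule summable_on_geometric_product) (use BW BV \<open>BW \<ge> 0\<close> \<open>BV \<ge> 0\<close> in auto)
    fix x :: "nat \<times> nat" assume "x \<in> UNIV \<times> UNIV"
    have "norm (moebius_coeff W q i j) * norm (moebius_coeff V q j i) \<le> BW * rW ^ i * (BV * rV ^ j)" for i j
      by (intro mult_mono BW BV) (auto intro: order_trans[OF norm_ge_zero BW(3)])
    then show "norm (f x) \<le> (case x of (i, j) \<Rightarrow> (BW * BV) * rW ^ i * rV ^ j)"
      by (auto simp: f_def norm_mult mult_ac split: prod.split)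
  qed
  then have "f summable_on UNIV \<times> UNIV" by (rule abs_summable_summable)
  then obtain S where S: "(f has_sum S) (UNIV \<times> UNIV)" by (auto simp: summable_on_def)
  \<comment> \<open>Absolute summability allows \<open>j\<close> to be the outer index, so that the
    sum over \<open>i\<close> is taken first.\<close>
  then have S': "((\<lambda>(j, i). f (i, j)) has_sum S) (UNIV \<times> UNIV)"
    by (subst has_sum_swap) (simp add: case_prod_unfold)
  have nzW: "den W t \<noteq> 0" and nzV: "den V t \<noteq> 0" and nzX: "den X t \<noteq> 0" if "cmod t \<le> 1" for t
    using maps_disc_den_nonzero W V X that by blast+
  define F where "F t = 1 / den X t ^ q" for t
  \<comment> \<open>The fixed points of \<open>X\<close> are the roots of a polynomial of degree at
    most two. One root is \<open>t0\<close>, and the trace determines the cofactor.\<close>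
  have fac: "t * den X t - num X t = (t - t0) * (den X t - b)" for t
  proof -
    have x11: "X$1$1 = a - X$2$1 * t0" and x12: "X$1$2 = a * t0 - X$2$2 * t0"
      using tX unfolding num_def den_def by (simp_all add: algebra_simps)
    have x22: "X$2$2 = b + X$2$1 * t0" using x11 trX by algebra
    show ?thesis unfolding num_def den_def x12 x11 x22 by (simp add: algebra_simps)
  qed
  \<comment> \<open>For fixed \<open>j\<close> the sum over \<open>i\<close> substitutes the Moebius
    map of \<open>W\<close> into the function belonging to \<open>V\<close>; by
    \<open>num_den_matrix_mul\<close> the result is the function belonging to
    \<open>X\<close>.\<close>
  have inner: "((\<lambda>i. f (i, j)) has_sum circle_coeff (\<lambda>t. F t * (num X t / den X t) ^ j) j) UNIV" for j
  proof (rule norm_summable_imp_has_sum)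
    show "summable (\<lambda>i. norm (f (i, j)))"
    proof (rule summable_comparison_test')
      show "summable (\<lambda>i. (BW * rW ^ i) * BV * rV ^ j)"
        using BW by (intro summable_mult summable_mult2 summable_geometric) simp
      show "norm (norm (f (i, j))) \<le> (BW * rW ^ i) * BV * rV ^ j" for i
      proof -
        have "norm (moebius_coeff W q i j) * norm (moebius_coeff V q j i) \<le> BW * rW ^ i * (BV * rV ^ j)"
          by (intro mult_mono BW BV) (auto intro: order_trans[OF norm_ge_zero BW(3)])
        then show ?thesis by (simp add: f_def norm_mult mult.assoc)
      qed
    qed
    obtain r where r: "0 < r" "r < 1" "maps_disc 1 2 W 1 r" using W by (rule maps_disc_shrink)
    have "(\<lambda>i. circle_coeff (\<lambda>t. (1 / den W t ^ q) * (num W t / den W t) ^ i) j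
         * circle_coeff (\<lambda>u. num V u ^ j / den V u ^ (j + q)) i) sums
       circle_coeff (\<lambda>t. (1 / den W t ^ q) * (num V (num W t / den W t) ^ j / den V (num W t / den W t) ^ (j + q))) j"
    proof (rule circle_coeff_compose_sums[OF _ _ r(2)])
      show "continuous_on (sphere 0 1) (\<lambda>t. 1 / den W t ^ q)"
        "continuous_on (sphere 0 1) (\<lambda>t. num W t / den W t)"
        using nzW by (auto intro!: continuous_intros)
      show "continuous_on (cball 0 1) (\<lambda>u. num V u ^ j / den V u ^ (j + q))"
        using nzV by (auto intro!: continuous_intros)
      show "(\<lambda>u. num V u ^ j / den V u ^ (j + q)) holomorphic_on ball 0 1"
        using nzV by (auto intro!: holomorphic_intros)
      show "norm (num W t / den W t) \<le> r" if "t \<in> sphere 0 1" for t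
        using r(3) that nzW[of t] unfolding maps_disc_1_2_iff
        by (simp add: norm_divide divide_le_eq less_imp_le)
    qed
    moreover have "circle_coeff (\<lambda>t. (1 / den W t ^ q) * (num V (num W t / den W t) ^ j / den V (num W t / den W t) ^ (j + q))) j
        = circle_coeff (\<lambda>t. F t * (num X t / den X t) ^ j) j"
    proof (rule circle_coeff_cong)
      fix t :: complex assume t: "t \<in> sphere 0 1"
      show "(1 / den W t ^ q) * (num V (num W t / den W t) ^ j / den V (num W t / den W t) ^ (j + q)) =
          F t * (num X t / den X t) ^ j"
        using t nzW[of t] unfolding X_def F_def
        by (simp add: num_den_matrix_mul power_add power_mult_distrib power_divide)
    qed
    moreover have "circle_coeff (\<lambda>t. (1 / den W t ^ q) * (num W t / den W t) ^ i) j
         * circle_coeff (\<lambda>u. num V u ^ j / den V u ^ (j + q)) i = f (i, j)" for i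
      by (simp add: f_def moebius_coeff_def power_add power_divide mult.commute)
    ultimately show "(\<lambda>i. f (i, j)) sums circle_coeff (\<lambda>t. F t * (num X t / den X t) ^ j) j"
      by simp
  qed
  have "((\<lambda>j. circle_coeff (\<lambda>t. F t * (num X t / den X t) ^ j) j) has_sum S) UNIV"
    using has_sum_SigmaD[OF S'] inner by auto
  then have "(\<lambda>j. circle_coeff (\<lambda>t. F t * (num X t / den X t) ^ j) j) sums S"
    by (rule has_sum_imp_sums)
  moreover obtain r where r: "0 < r" "r < 1" "maps_disc 1 2 X 1 r" using X by (rule maps_disc_shrink)
  have "(\<lambda>j. circle_coeff (\<lambda>t. F t * (num X t / den X t) ^ j) j) sums
    (contour_integral (circlepath 0 1) (\<lambda>t. F t / (t - num X t / den X t)) / (2 * of_real pi * \<i>))"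
  proof (rule circle_coeff_diagonal_sums[OF _ _ r(2)])
    show "continuous_on (sphere 0 1) F" "continuous_on (sphere 0 1) (\<lambda>t. num X t / den X t)"
      unfolding F_def using nzX by (auto intro!: continuous_intros)
    show "norm (num X t / den X t) \<le> r" if "t \<in> sphere 0 1" for t
      using r(3) that nzX[of t] unfolding maps_disc_1_2_iff
      by (simp add: norm_divide divide_le_eq less_imp_le)
  qed
  ultimately have "S = contour_integral (circlepath 0 1) (\<lambda>t. F t / (t - num X t / den X t)) / (2 * of_real pi * \<i>)"
    by (rule sums_unique2)
  also have "contour_integral (circlepath 0 1) (\<lambda>t. F t / (t - num X t / den X t)) =
    contour_integral (circlepath 0 1) (\<lambda>t. 1 / (den X t ^ p * (den X t - b)) / (t - t0))"
  proof (rule contour_integral_eq)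
    fix t :: complex assume "t \<in> path_image (circlepath 0 1)"
    then have nz: "den X t \<noteq> 0" using nzX[of t] by simp
    \<comment> \<open>Clearing the denominator of the Moebius map uses one of the \<open>q\<close>
      factors \<open>den X t\<close> and leaves \<open>p\<close>.\<close>
    have "F t / (t - num X t / den X t) = 1 / (den X t ^ p * (t * den X t - num X t))"
    proof -
      have "t - num X t / den X t = (t * den X t - num X t) / den X t" using nz by (simp add: field_simps)
      then show ?thesis using nz by (simp add: F_def q_def)
    qed
    then show "F t / (t - num X t / den X t) = 1 / (den X t ^ p * (den X t - b)) / (t - t0)"
      by (simp add: fac mult_ac)
  qed
  also have "\<dots> / (2 * of_real pi * \<i>) = 1 / (den X t0 ^ p * (den X t0 - b))"
  proof (rule Cauchy_integral_circlepath_unit)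
    \<comment> \<open>By \<open>fac\<close> a zero of \<open>den X t - b\<close> is a fixed point
      with eigenvalue \<open>b\<close>, which is excluded.\<close>
    have nb: "den X t \<noteq> b" if "cmod t \<le> 1" for t
    proof
      assume *: "den X t = b"
      with fac[of t] have "num X t = b * t" by (simp add: mult.commute)
      with b[OF that] * show False by (simp add: X_def)
    qed
    show "continuous_on (cball 0 1) (\<lambda>t. 1 / (den X t ^ p * (den X t - b)))"
      using nzX nb by (auto intro!: continuous_intros)
    show "(\<lambda>t. 1 / (den X t ^ p * (den X t - b))) holomorphic_on ball 0 1"
      using nzX nb by (auto intro!: holomorphic_intros)
  qed (use t0 in auto)
  finally show ?thesis using S tX(1) by (simp add: f_def q_def)
qed

section \<open>Fixed points\<close>

text \<open>The pair \<open>(d, e)\<close> gives homogeneous coordinates of the point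
  \<open>e / d\<close>, so that orbits can be followed as row vectors without division.\<close>

lemma maps_disc_homogeneous:
  assumes "maps_disc 1 2 X a b" "d \<noteq> 0" "cmod e \<le> a * cmod d"
  shows "cmod (X$1$2 * d + X$2$2 * e) < b * cmod (X$1$1 * d + X$2$1 * e)"
proof -
  have "cmod (e / d) \<le> a" using assms(2,3) by (simp add: norm_divide divide_le_eq)
  then have "cmod (num X (e / d)) * cmod d < b * cmod (den X (e / d)) * cmod d"
    using assms unfolding maps_disc_1_2_iff by simp
  moreover have "X$1$2 * d + X$2$2 * e = num X (e / d) * d" "X$1$1 * d + X$2$1 * e = den X (e / d) * d"
    using assms(2) by (simp_all add: num_def den_def field_simps)
  ultimately show ?thesis by (simp add: norm_mult mult.assoc)
qed

text \<open>The iterates of the point \<open>0\<close> of the disc converge to the fixed point with eigenvalue \<open>a\<close>.\<close>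

lemma dominant_fixed_point_in_disc:
  assumes X: "maps_disc 1 2 X 1 1"
    and u: "X$1$1 * p + X$2$1 * r = a * p" "X$1$2 * p + X$2$2 * r = a * r"
    and v: "X$1$1 * p' + X$2$1 * r' = b * p'" "X$1$2 * p' + X$2$2 * r' = b * r'"
    and one: "p + p' = 1" "r + r' = 0" and p: "p \<noteq> 0" and ab: "cmod b < cmod a"
  shows "cmod (r / p) < 1" "den X (r / p) = a" "num X (r / p) = a * (r / p)"
proof -
  have a0: "a \<noteq> 0" using ab by auto
  define k where "k = b / a"
  have k: "cmod k < 1" using ab a0 by (simp add: k_def norm_divide)
  have bk: "b = a * k" using a0 by (simp add: k_def)
  \<comment> \<open>By \<open>one\<close> the point 0, represented by \<open>(1, 0)\<close>, is the
    sum of the eigenvectors \<open>(p, r)\<close> and \<open>(p', r')\<close>. The pair treated here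
    is its image under the \<open>n\<close>-th power of \<open>X\<close>, divided by
    \<open>a ^ n\<close>.\<close>
  have "p + k ^ n * p' \<noteq> 0 \<and> cmod (r + k ^ n * r') \<le> 1 * cmod (p + k ^ n * p')" for n
  proof (induction n)
    case 0
    show ?case using one by simp
  next
    case (Suc n)
    have "X$1$2 * (p + z * p') + X$2$2 * (r + z * r') = a * (r + k * z * r')"
      "X$1$1 * (p + z * p') + X$2$1 * (r + z * r') = a * (p + k * z * p')" for z
      using u v unfolding bk by algebra+
    from this[of "k ^ n"]
    have "X$1$2 * (p + k ^ n * p') + X$2$2 * (r + k ^ n * r') = a * (r + k ^ Suc n * r')"
      "X$1$1 * (p + k ^ n * p') + X$2$1 * (r + k ^ n * r') = a * (p + k ^ Suc n * p')"
      by simp_all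
    moreover note maps_disc_homogeneous[OF X, of "p + k ^ n * p'" "r + k ^ n * r'"] Suc
    ultimately have "cmod (r + k ^ Suc n * r') < cmod (p + k ^ Suc n * p')" using a0
      by (simp add: norm_mult)
    then show ?case by auto
  qed
  then have *: "cmod (r + k ^ n * r') \<le> cmod (p + k ^ n * p')" for n by simp
  have k0: "(\<lambda>n. k ^ n) \<longlonglongrightarrow> 0" using k by (rule LIMSEQ_power_zero)
  have lim: "(\<lambda>n. x + k ^ n * y) \<longlonglongrightarrow> x" for x y
    using tendsto_add[OF tendsto_const[of x] tendsto_mult[OF k0 tendsto_const[of y]]] by simp
  have "cmod r \<le> cmod p"
    by (rule LIMSEQ_le[where X = "\<lambda>n. cmod (r + k ^ n * r')" and Y = "\<lambda>n. cmod (p + k ^ n * p')"])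
       (use * in \<open>auto intro!: tendsto_norm lim\<close>)
  then have "cmod r \<le> 1 * cmod p" by simp
  \<comment> \<open>The limit lies in the closed disc and is its own image, hence it lies in the
    open disc.\<close>
  from maps_disc_homogeneous[OF X p this] show "cmod (r / p) < 1"
    using a0 p by (simp add: u norm_mult norm_divide)
  show "den X (r / p) = a" "num X (r / p) = a * (r / p)"
    using u p by (simp_all add: num_def den_def field_simps)
qed

text \<open>The backward orbit of \<open>\<infinity>\<close> stays outside the disc and converges to the fixed point
  with eigenvalue \<open>b\<close>.\<close>

lemma other_fixed_point_not_in_disc:
  assumes X: "maps_disc 1 2 X 1 1"
    and u: "den X s = a" "num X s = a * s"
    and v: "den X t = b" "num X t = b * t" "cmod t \<le> 1"
    and b: "b \<noteq> 0" "cmod b < cmod a"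
  shows False
proof -
  have a0: "a \<noteq> 0" using b by auto
  define k where "k = b / a"
  have k: "cmod k < 1" using b a0 by (simp add: k_def norm_divide)
  have bk: "b = a * k" and "k \<noteq> 0" using a0 b by (auto simp: k_def)
  have "s \<noteq> t" using u v b by auto
  have n1: "k ^ Suc n \<noteq> 1" for n
  proof
    assume "k ^ Suc n = 1"
    then have "cmod k ^ Suc n = 1" by (metis norm_power norm_one)
    then show False using k power_less_one_iff[of "cmod k" "Suc n"] by simp
  qed
  \<comment> \<open>The pair \<open>(1 - k ^ n, t - k ^ n * s)\<close> combines the eigenvectors
    \<open>(1, t)\<close> and \<open>(1, s)\<close>; it represents infinity for
    \<open>n = 0\<close>, and \<open>X\<close> maps the pair for \<open>Suc n\<close> to
    \<open>b\<close> times the pair for \<open>n\<close>. If the later point were in the closed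
    disc, its image would be in the open disc.\<close>
  have *: "cmod (1 - k ^ n) < cmod (t - k ^ n * s)" for n
  proof (induction n)
    case 0
    then show ?case using \<open>s \<noteq> t\<close> by simp
  next
    case (Suc n)
    show ?case
    proof (rule ccontr)
      assume "\<not> ?case"
      with maps_disc_homogeneous[OF X, of "1 - k ^ Suc n" "t - k ^ Suc n * s"] n1[of n]
      have "cmod (X$1$2 * (1 - k ^ Suc n) + X$2$2 * (t - k ^ Suc n * s))
         < cmod (X$1$1 * (1 - k ^ Suc n) + X$2$1 * (t - k ^ Suc n * s))" by simp
      also have "X$1$2 * (1 - k ^ Suc n) + X$2$2 * (t - k ^ Suc n * s) = num X t - k ^ Suc n * num X s"
        by (simp add: num_def algebra_simps)
      also have "\<dots> = b * (t - k ^ n * s)" using u v(1,2) by (simp add: bk algebra_simps)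
      also have "X$1$1 * (1 - k ^ Suc n) + X$2$1 * (t - k ^ Suc n * s) = den X t - k ^ Suc n * den X s"
        by (simp add: den_def algebra_simps)
      also have "\<dots> = b * (1 - k ^ n)" using u v(1,2) by (simp add: bk algebra_simps)
      finally have "cmod (b * (t - k ^ n * s)) < cmod (b * (1 - k ^ n))" .
      then show False using Suc b by (simp add: norm_mult)
    qed
  qed
  have k0: "(\<lambda>n. k ^ n) \<longlonglongrightarrow> 0" using k by (rule LIMSEQ_power_zero)
  have lim: "(\<lambda>n. x - k ^ n * y) \<longlonglongrightarrow> x" for x y
    using tendsto_diff[OF tendsto_const[of x] tendsto_mult[OF k0 tendsto_const[of y]]] by simp
  have "cmod 1 \<le> cmod t"
  proof (rule LIMSEQ_le)
    show "(\<lambda>n. cmod (1 - k ^ n)) \<longlonglongrightarrow> cmod 1" by (rule tendsto_norm) (use lim[of 1 1] in simp)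
    show "(\<lambda>n. cmod (t - k ^ n * s)) \<longlonglongrightarrow> cmod t" by (rule tendsto_norm[OF lim])
    show "\<exists>N. \<forall>n\<ge>N. cmod (1 - k ^ n) \<le> cmod (t - k ^ n * s)" using * less_imp_le by blast
  qed
  \<comment> \<open>A fixed point in the closed disc lies in the open disc, contrary to the limit
    just obtained.\<close>
  moreover have "cmod (b * t) < cmod b"
    using X v unfolding maps_disc_1_2_iff by (metis mult_1)
  ultimately show False using b by (simp add: norm_mult)
qed

section \<open>Matrix coefficients and rescaling\<close>

text \<open>This is \<open>diag2 1 a ** Y ** diag2 1 (1 / b)\<close>: the variable is multiplied by
  \<open>a\<close> and the value divided by \<open>b\<close>, so discs of radii \<open>a\<close> and
  \<open>b\<close> become unit discs.\<close>

definition rescale :: "complex \<Rightarrow> complex \<Rightarrow> complex^2^2 \<Rightarrow> complex^2^2" where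
  "rescale a b Y = vector [vector [Y$1$1, Y$1$2 / b], vector [a * Y$2$1, a * Y$2$2 / b]]"

lemma rescale_entry [simp]:
  "rescale a b Y$1$1 = Y$1$1" "rescale a b Y$1$2 = Y$1$2 / b"
  "rescale a b Y$2$1 = a * Y$2$1" "rescale a b Y$2$2 = a * Y$2$2 / b"
  by (simp_all add: rescale_def)

lemma rescale_mul: "b \<noteq> 0 \<Longrightarrow> rescale a b W ** rescale b c V = rescale a c (W ** V)"
  by (simp add: vec_eq_iff forall_2 matrix_mul_entry add_divide_distrib algebra_simps)

lemma maps_disc_rescale:
  assumes "maps_disc 1 2 Y a b" "a > 0" "b > 0"
  shows "maps_disc 1 2 (rescale a b Y) 1 1"
  unfolding maps_disc_1_2_iff
proof (intro allI impI)
  fix t :: complex assume "cmod t \<le> 1"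
  then have "cmod (num Y (a * t)) < b * cmod (den Y (a * t))"
    using assms(1,2) unfolding maps_disc_1_2_iff by (simp add: norm_mult)
  moreover have "num (rescale a b Y) t = num Y (a * t) / b" "den (rescale a b Y) t = den Y (a * t)"
    by (simp_all add: num_def den_def add_divide_distrib)
  ultimately show "cmod (num (rescale a b Y) t) < 1 * cmod (den (rescale a b Y) t)"
    using assms(3) by (simp add: norm_divide divide_less_eq mult.commute)
qed

text \<open>Each summand contains \<open>j\<close> factors from the second row and \<open>i\<close>
  factors from the second column, so all summands scale by \<open>a ^ j / b ^ i\<close>.\<close>

lemma tau_sum_rescale:
  assumes "a \<noteq> 0" "b \<noteq> 0"
  shows "tau_sum i (j + p) (i + p) (rescale a b Y) * b ^ i = tau_sum i (j + p) (i + p) Y * a ^ j"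
  unfolding tau_sum_def sum_distrib_right
proof (rule sum.cong[OF refl])
  fix s assume "s \<in> {s. s \<le> i \<and> i + p \<le> s + (j + p)}"
  then have s: "s \<le> i" "i \<le> s + j" by auto
  then have b: "b ^ i = b ^ s * b ^ (i - s)" by (simp flip: power_add)
  have a: "a ^ j = a ^ (i - s) * a ^ (s + (j + p) - (i + p))" using s by (simp flip: power_add)
  have m: "- (a * Y$2$1) = a * (- Y$2$1)" by simp
  show "of_nat (i choose s) * of_nat ((s + (j + p)) choose (i + p)) *
         rescale a b Y$1$2 ^ s * rescale a b Y$2$2 ^ (i - s) *
         (- rescale a b Y$2$1) ^ (s + (j + p) - (i + p)) / rescale a b Y$1$1 ^ (s + (j + p) + 1) * b ^ i =
        of_nat (i choose s) * of_nat ((s + (j + p)) choose (i + p)) *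
         Y$1$2 ^ s * Y$2$2 ^ (i - s) *
         (- Y$2$1) ^ (s + (j + p) - (i + p)) / Y$1$1 ^ (s + (j + p) + 1) * a ^ j"
    unfolding a b rescale_entry m power_mult_distrib power_divide using assms by simp
qed

text \<open>If \<open>a < 1\<close>, the pole of the integrand for \<open>Y\<close> may lie outside
  the unit circle, and then the integral need not give \<open>tau\<close>. The rational expression
  \<open>tau_sum\<close> needs only \<open>Y$1$1 \<noteq> 0\<close>; it is rescaled first and then
  read as an integral for the rescaled matrix.\<close>

lemma tau_eq_moebius_coeff:
  fixes a b :: real
  assumes Y: "maps_disc 1 2 Y a b" "a > 0" "b > 0"
    and l: "2 * l = - real (Suc p)" and m: "m = real i - l" and n: "n = real j - l"
  shows "tau l n m Y = moebius_coeff (rescale a b Y) (Suc p) i j * of_real b ^ i / of_real a ^ j"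
proof -
  have e: "l - m = of_int (- int (Suc (i + p)))" "l + m = of_int (int i)" "n - l = of_int (int (Suc (j + p)))"
    using l m n by simp_all
  then have fl: "\<lfloor>l - m\<rfloor> = - int (Suc (i + p))" "\<lfloor>l + m\<rfloor> = int i" "\<lfloor>n - l\<rfloor> = int (Suc (j + p))"
    by (simp_all only: floor_of_int)
  define Y' where "Y' = rescale a b Y"
  have Y': "maps_disc 1 2 Y' 1 1" unfolding Y'_def by (rule maps_disc_rescale[OF Y])
  have "Y$1$1 \<noteq> 0" using maps_disc_den_nonzero[OF Y(1), of 0] Y by (simp add: den_def)
  from tau_eqI[OF rational_value_tau_sum[OF fl this]]
  have "tau l n m Y = tau_sum i (j + p) (i + p) Y" .
  also have "\<dots> = tau_sum i (j + p) (i + p) Y' * of_real b ^ i / of_real a ^ j"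
    using tau_sum_rescale[of a b i j p Y] Y unfolding Y'_def by (simp add: field_simps)
  also have "tau_sum i (j + p) (i + p) Y' = tau_integral l n m Y'"
  proof (rule tau_integral_eq_sum[OF fl, symmetric])
    show "cmod (Y'$2$1) < cmod (Y'$1$1)"
    \<comment> \<open>Otherwise the zero of \<open>den Y'\<close> would lie in the closed unit
      disc.\<close>
    proof (rule ccontr)
      assume *: "\<not> ?thesis"
      have "Y'$1$1 \<noteq> 0" using maps_disc_den_nonzero[OF Y', of 0] by (simp add: den_def)
      then have "cmod (- Y'$1$1 / Y'$2$1) \<le> 1" "Y'$2$1 \<noteq> 0" using * by (auto simp: norm_divide divide_le_eq)
      with maps_disc_den_nonzero[OF Y' this(1)] show False by (simp add: den_def)
    qed
  qed
  also have "\<dots> = moebius_coeff Y' (Suc p) i j"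
    unfolding moebius_coeff_def by (rule tau_integral_eq_circle_coeff) (use fl in auto)
  finally show ?thesis unfolding Y'_def .
qed

section \<open>Diagonalization by elements of \<open>SU11\<close> and the order of the
  eigenvalues\<close>

lemma matrix_left_inverse_unique:
  fixes A B :: "complex^2^2"
  assumes "B ** A = mat 1"
  shows "matrix_inv A = B"
proof -
  have "det B * det A = 1" unfolding det_mul[symmetric] assms by simp
  then have "A ** matrix_inv A = mat 1" by (intro invertible_inv) auto
  then have "B = B ** (A ** matrix_inv A)" by simp
  also have "\<dots> = matrix_inv A" unfolding matrix_mul_assoc assms by simp
  finally show ?thesis ..
qed

lemma SU11_inverse:
  assumes "g \<in> SU11"
  shows "matrix_inv g = vector [vector [cnj (g$1$1), - g$1$2], vector [- cnj (g$1$2), g$1$1]]"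
  by (rule matrix_left_inverse_unique)
     (use assms in \<open>auto simp: SU11_def vec_eq_iff forall_2 matrix_mul_entry det_2 mat_def algebra_simps\<close>)

lemma SU11_conjugate_entry:
  fixes g :: "complex^2^2" and a b :: complex
  assumes "g \<in> SU11"
  defines "X \<equiv> g ** diag2 a b ** matrix_inv g" and "P \<equiv> g$1$1 * cnj (g$1$1)" and "R \<equiv> g$1$2 * cnj (g$1$2)"
  shows "X$1$1 = a * P - b * R" "X$1$2 = - g$1$1 * g$1$2 * (a - b)"
    "X$2$1 = cnj (g$1$1) * cnj (g$1$2) * (a - b)" "X$2$2 = b * P - a * R" "P - R = 1"
  unfolding X_def P_def R_def SU11_inverse[OF assms(1)] using assms(1)
  by (auto simp: matrix_mul_entry SU11_def det_2 algebra_simps)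

text \<open>The given diagonalization may differ from the one in the definition of
  \<open>Gamma_minus\<close>. Trace and determinant show that the eigenvalues agree up to order, and
  the signature form decides the order.\<close>

lemma Gamma_minus_eigenvalues:
  assumes g: "g \<in> SU11" and X: "g ** diag2 a b ** matrix_inv g \<in> Gamma_minus"
  shows "cmod a > 1" "cmod b < 1" "b \<noteq> 0"
proof -
  obtain h c d where h: "g ** diag2 a b ** matrix_inv g = h ** diag2 c d ** matrix_inv h" "h \<in> SU11"
    "cmod c > 1" "1 > cmod d" "cmod d > 0"
    using X unfolding Gamma_minus_def by blast
  \<comment> \<open>On \<open>e\<close> the form vanishes, and on its image under
    \<open>diag2 a b\<close> it is the difference of the squared moduli of \<open>a\<close> and
    \<open>b\<close>.\<close>
  define e where "e = (vector [1, 1] :: complex^2)"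
  have e: "e$1 = 1" "e$2 = 1" by (simp_all add: e_def)
  have dg: "det g \<noteq> 0" using g by (simp add: SU11_def)
  have "e v* matrix_inv g \<noteq> 0"
  proof
    assume "e v* matrix_inv g = 0"
    then have "(e v* matrix_inv g) v* g = 0" by simp
    then have "e = 0" by (simp add: invertible_inv(2)[OF dg] flip: vmul_assoc)
    then show False using e by (simp add: vec_eq_iff)
  qed
  moreover have "signature_form (e v* matrix_inv g) \<ge> 0"
    by (simp add: SU11_inv_form[OF g]) (simp add: signature_form_def e)
  ultimately have "signature_form ((e v* matrix_inv g) v* (g ** diag2 a b ** matrix_inv g)) > 0"
    by (intro Gamma_minus_form[OF X])
  moreover have "(e v* matrix_inv g) v* (g ** diag2 a b ** matrix_inv g) = (e v* diag2 a b) v* matrix_inv g"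
    unfolding vmul_assoc[symmetric] matrix_mul_assoc invertible_inv(2)[OF dg] by simp
  ultimately have "signature_form (e v* diag2 a b) > 0" by (simp add: SU11_inv_form[OF g])
  then have "(cmod b)\<^sup>2 < (cmod a)\<^sup>2" by (simp add: signature_form_def vmul_entry e)
  then have ba: "cmod b < cmod a" by (rule power_less_imp_less_base) simp
  have inv: "det x * det (matrix_inv x) = 1" if "det x \<noteq> 0" for x :: "complex^2^2"
    unfolding det_mul[symmetric] invertible_inv(1)[OF that] by simp
  have "det g = 1" "det h = 1" using g h(2) by (simp_all add: SU11_def)
  then have "a * b = c * d"
    using arg_cong[OF h(1), of det] inv[of g] inv[of h] by (simp add: det_mul) (simp add: det_2)
  moreover have "a + b = c + d"
  proof -
    show ?thesis
      using arg_cong[OF h(1), of "\<lambda>X. X$1$1 + X$2$2"] SU11_conjugate_entry(5)[OF g] SU11_conjugate_entry(5)[OF h(2)]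
      unfolding SU11_conjugate_entry(1,4)[OF g] SU11_conjugate_entry(1,4)[OF h(2)] by algebra
  qed
  ultimately have "(a - c) * (a - d) = 0" by algebra
  then have "a = c \<and> b = d \<or> a = d \<and> b = c" using \<open>a + b = c + d\<close> by auto
  then show "cmod a > 1" "cmod b < 1" "b \<noteq> 0" using h ba by auto
qed

section \<open>The sums over the weights\<close>

lemma hol_weights_eq_range:
  assumes "l = - 1 - real j / 2"
  shows "hol_weights l = range (\<lambda>i. real i - l)"
proof (intro equalityI subsetI)
  fix m assume "m \<in> hol_weights l"
  then obtain x where x: "m - l = of_int x" "m \<ge> - l" unfolding hol_weights_def Ints_def by auto
  then have "m = real (nat (x - 2 - int j)) - l" using assms by auto
  then show "m \<in> range (\<lambda>i. real i - l)" by blast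
next
  fix m assume "m \<in> range (\<lambda>i. real i - l)"
  then obtain i where i: "m = real i - l" by auto
  then have "m - l = of_int (int i + 2 + int j)" using assms by simp
  then have "m - l \<in> \<int>" by (metis Ints_of_int)
  then show "m \<in> hol_weights l" using i by (simp add: hol_weights_def)
qed

lemma det_conjugate_diag2:
  assumes "g \<in> SU11"
  shows "det (g ** diag2 a b ** matrix_inv g) = a * b"
proof -
  have "det g \<noteq> 0" using assms by (simp add: SU11_def)
  from invertible_inv(1)[OF this] have "det g * det (matrix_inv g) = 1"
    unfolding det_mul[symmetric] by simp
  then show ?thesis unfolding det_mul by (simp add: det_2)
qed

text \<open>The scalings of \<open>W\<close> and of \<open>V\<close> cancel in the product of the
  coefficients, so the sum is the trace for the rescaled matrices. Their product is conjugate to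
  \<open>W ** V\<close> and keeps its eigenvalues.\<close>

lemma hol_kernel_sum_over_weights:
  fixes W Z g :: "complex^2^2"
  assumes Z: "det Z \<noteq> 0" and g: "g \<in> SU11" and X: "W ** matrix_inv Z = g ** diag2 a b ** matrix_inv g"
    and G: "W ** matrix_inv Z \<in> Gamma_minus" and c: "composable 1 2 W Z" and l: "l = - 1 - real j / 2"
  shows "((\<lambda>(m, n). kernel_term W Z l k m n) has_sum
    det Z powi (- 2) * (of_nat (Suc j) * (a * b) powi k / (a ^ Suc j * (a - b))))
      (hol_weights l \<times> hol_weights l)"
proof -
  define V where "V = matrix_inv Z"
  note X' = X[folded V_def]
  obtain r s where rs: "r > 0" "s > 0" "maps_disc 1 2 W r s" "maps_disc 1 2 V s r"
    using c by (auto simp: composable_def V_def)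
  define W1 where "W1 = rescale r s W"
  define V1 where "V1 = rescale s r V"
  have d: "maps_disc 1 2 W1 1 1" "maps_disc 1 2 V1 1 1"
    unfolding W1_def V1_def by (intro maps_disc_rescale rs)+
  have X1: "W1 ** V1 = rescale r r (W ** V)"
    unfolding W1_def V1_def by (rule rescale_mul) (use rs in simp)
  note ab = Gamma_minus_eigenvalues[OF g G[unfolded X]]
  define P where "P = g$1$1 * cnj (g$1$1)"
  define R where "R = g$1$2 * cnj (g$1$2)"
  note e = SU11_conjugate_entry(1-4)[OF g, of a b, folded P_def R_def X']
    and PR = SU11_conjugate_entry(5)[OF g, folded P_def R_def]
  have P: "P = complex_of_real ((cmod (g$1$1))\<^sup>2)" and R: "R = complex_of_real ((cmod (g$1$2))\<^sup>2)"
    unfolding P_def R_def complex_norm_square by simp_all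
  have "(cmod (g$1$1))\<^sup>2 = 1 + (cmod (g$1$2))\<^sup>2"
  proof -
    have "complex_of_real ((cmod (g$1$1))\<^sup>2 - (cmod (g$1$2))\<^sup>2) = 1"
      using PR unfolding P R by (simp only: of_real_diff)
    then have "(cmod (g$1$1))\<^sup>2 - (cmod (g$1$2))\<^sup>2 = 1" using of_real_eq_1_iff by blast
    then show ?thesis by simp
  qed
  then have "(cmod (g$1$1))\<^sup>2 > 0" by (simp add: add_pos_nonneg)
  then have P0: "P \<noteq> 0" unfolding P by simp
  \<comment> \<open>Multiplying the rows of \<open>matrix_inv g\<close> by \<open>g$1$1\<close> and
    \<open>g$1$2\<close> gives left eigenvectors of \<open>W ** V\<close> with sum
    \<open>(1, 0)\<close>. After rescaling they are \<open>(P, - h)\<close> and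
    \<open>(- R, h)\<close>.\<close>
  define h where "h = g$1$1 * g$1$2 / r"
  have r0: "complex_of_real r \<noteq> 0" using rs by simp
  have hr: "g$1$1 * g$1$2 = h * r" "cnj (g$1$1) * cnj (g$1$2) * (h * r) = P * R"
    using r0 by (simp_all add: h_def P_def R_def)
  have x: "(W1 ** V1)$1$1 = a * P - b * R" "(W1 ** V1)$1$2 = - h * (a - b)"
     "(W1 ** V1)$2$1 = cnj (g$1$1) * cnj (g$1$2) * r * (a - b)" "(W1 ** V1)$2$2 = b * P - a * R"
    unfolding X1 using e r0 by (simp_all add: h_def mult.assoc)
  have u: "(W1 ** V1)$1$1 * P + (W1 ** V1)$2$1 * (- h) = a * P"
    "(W1 ** V1)$1$2 * P + (W1 ** V1)$2$2 * (- h) = a * (- h)"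
    "(W1 ** V1)$1$1 * (- R) + (W1 ** V1)$2$1 * h = b * (- R)"
    "(W1 ** V1)$1$2 * (- R) + (W1 ** V1)$2$2 * h = b * h"
    unfolding x using PR hr(2) by algebra+
  have "cmod b < cmod a" using ab by simp
  note t = dominant_fixed_point_in_disc[OF maps_disc_matrix_mul[OF d] u _ _ P0 this]
  have t: "cmod (- h / P) < 1" "den (W1 ** V1) (- h / P) = a" "num (W1 ** V1) (- h / P) = a * (- h / P)"
    by (rule t; use PR in simp)+
  have tr: "(W1 ** V1)$1$1 + (W1 ** V1)$2$2 = a + b" unfolding x using PR by algebra
  \<comment> \<open>Here \<open>- 2 * l = j + 2\<close>, so the exponent of \<open>a\<close> in the
    trace is \<open>j + 1 = - (2 * l + 1)\<close>.\<close>
  have T: "((\<lambda>(i, i'). moebius_coeff W1 (Suc (Suc j)) i i' * moebius_coeff V1 (Suc (Suc j)) i' i) has_sum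
      1 / (a ^ Suc j * (a - b))) UNIV"
    by (rule moebius_coeff_trace[OF d t _ tr])
       (use other_fixed_point_not_in_disc[OF maps_disc_matrix_mul[OF d] t(2,3) _ _ _ ab(3)] ab in auto)
  define C where "C = det Z powi (- 2) * of_nat (Suc j) * (a * b) powi k"
  have dX: "det W = a * b * det Z"
  proof -
    have "det (W ** V) * det Z = det W"
      unfolding V_def det_mul[symmetric] matrix_mul_assoc[symmetric] invertible_inv(2)[OF Z] by simp
    moreover have "det (W ** V) = a * b" unfolding X' by (rule det_conjugate_diag2[OF g])
    ultimately show ?thesis by simp
  qed
  have dd: "det W powi k * det Z powi (- k - 2) = (a * b) powi k * det Z powi (- 2)"
    unfolding dX power_int_mult_distrib mult.assoc using Z by (simp flip: power_int_add)
  have kt: "kernel_term W Z l k (real i - l) (real i' - l) =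
      C * (moebius_coeff W1 (Suc (Suc j)) i i' * moebius_coeff V1 (Suc (Suc j)) i' i)" for i i'
  proof -
    have 2: "2 * l = - real (Suc (Suc j))" using l by simp
    have "tau l (real i' - l) (real i - l) W = moebius_coeff W1 (Suc (Suc j)) i i' * of_real s ^ i / of_real r ^ i'"
      unfolding W1_def by (rule tau_eq_moebius_coeff[OF rs(3,1,2) 2]) auto
    moreover have "tau l (real i - l) (real i' - l) V = moebius_coeff V1 (Suc (Suc j)) i' i * of_real r ^ i' / of_real s ^ i"
      unfolding V1_def by (rule tau_eq_moebius_coeff[OF rs(4,2,1) 2]) auto
    \<comment> \<open>The factors \<open>s ^ i\<close> and \<open>r ^ i'\<close> occur once in a
      numerator and once in a denominator.\<close>
    ultimately have tt: "tau l (real i' - l) (real i - l) W * tau l (real i - l) (real i' - l) V =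
        moebius_coeff W1 (Suc (Suc j)) i i' * moebius_coeff V1 (Suc (Suc j)) i' i"
      using rs by simp
    have "- (2 * l + 1) = real (Suc j)" using l by simp
    then have "kernel_term W Z l k (real i - l) (real i' - l) = of_nat (Suc j)
       * (tau l (real i' - l) (real i - l) W * tau l (real i - l) (real i' - l) V) * (det W powi k * det Z powi (- k - 2))"
      by (simp only: kernel_term_def V_def of_real_of_nat_eq mult_ac)
    also have "\<dots> = C * (moebius_coeff W1 (Suc (Suc j)) i i' * moebius_coeff V1 (Suc (Suc j)) i' i)"
      unfolding tt dd C_def by (simp only: mult_ac)
    finally show ?thesis .
  qed
  define f where "f = (\<lambda>(i, i'). (real i - l, real i' - l))"
  have "bij_betw f UNIV (hol_weights l \<times> hol_weights l)"
    unfolding bij_betw_def hol_weights_eq_range[OF l] by (auto simp: f_def inj_on_def image_def)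
  from has_sum_reindex_bij_betw[OF this, of "\<lambda>(m, n). kernel_term W Z l k m n"]
  have "((\<lambda>(m, n). kernel_term W Z l k m n) has_sum S) (hol_weights l \<times> hol_weights l) \<longleftrightarrow>
    ((\<lambda>(i, i'). C * (moebius_coeff W1 (Suc (Suc j)) i i' * moebius_coeff V1 (Suc (Suc j)) i' i)) has_sum S) UNIV" for S
    by (simp add: f_def case_prod_unfold kt)
  then show ?thesis
    using has_sum_cmult_right[OF T, of C] by (simp add: C_def case_prod_unfold mult.assoc)
qed

section \<open>The antiholomorphic series by exchange of the indices\<close>

lemma swap_indices_mul: "swap_indices (A ** B) = swap_indices A ** swap_indices B"
  by (simp add: vec_eq_iff forall_2 matrix_mul_entry add.commute)

lemma swap_indices_det: "det (swap_indices A) = det A"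
  by (simp add: det_2 mult.commute)

lemma swap_indices_inv:
  assumes "det A \<noteq> 0"
  shows "swap_indices (matrix_inv A) = matrix_inv (swap_indices A)"
proof -
  have "swap_indices (mat 1) = mat 1" by (simp add: vec_eq_iff forall_2 mat_def)
  then have "swap_indices (matrix_inv A) ** swap_indices A = mat 1"
    using invertible_inv(2)[OF assms] by (simp flip: swap_indices_mul)
  then show ?thesis by (rule matrix_left_inverse_unique[symmetric])
qed

text \<open>The exchange is conjugation by the permutation matrix, which reverses the order of the
  diagonal entries.\<close>

lemma swap_indices_conjugate:
  assumes "g \<in> SU11"
  shows "swap_indices (g ** diag2 a b ** matrix_inv g) = swap_indices g ** diag2 b a ** matrix_inv (swap_indices g)"
proof -
  have "swap_indices (diag2 a b) = diag2 b a" by (simp add: vec_eq_iff forall_2)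
  moreover have "det g \<noteq> 0" using assms by (simp add: SU11_def)
  ultimately show ?thesis by (simp add: swap_indices_mul swap_indices_inv)
qed

lemma swap_indices_Gamma_plus:
  assumes "Y \<in> Gamma_plus"
  shows "swap_indices Y \<in> Gamma_minus"
proof -
  obtain g a b where Y: "Y = g ** diag2 a b ** matrix_inv g" "g \<in> SU11"
      "cmod b > 1" "1 > cmod a" "cmod a > 0"
    using assms unfolding Gamma_plus_def by blast
  show ?thesis
    unfolding Gamma_minus_def Y(1) swap_indices_conjugate[OF Y(2)]
    using swap_indices_SU11[OF Y(2)] Y(3-5) by blast
qed

lemma Gamma_plus_eigenvalues:
  assumes g: "g \<in> SU11" and X: "g ** diag2 a b ** matrix_inv g \<in> Gamma_plus"
  shows "cmod b > 1" "cmod a < 1" "a \<noteq> 0"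
  using Gamma_minus_eigenvalues[OF swap_indices_SU11[OF g], of b a] swap_indices_Gamma_plus[OF X]
  unfolding swap_indices_conjugate[OF g] by blast+

lemma maps_disc_swap: "maps_disc 1 2 (swap_indices Y) a b \<longleftrightarrow> maps_disc 2 1 Y a b"
  by (simp add: maps_disc_def)

text \<open>The integrals agree by \<open>antihol_swap\<close>, and
  \<open>rational_value_swap\<close> carries this over to the rational functions, also where the
  integrals do not represent them.\<close>

lemma tau_antihol_eq_swap:
  assumes l: "l \<in> spins" and mn: "m \<in> antihol_weights l" "n \<in> antihol_weights l" and Y: "Y$2$2 \<noteq> 0"
  shows "tau l n m Y = tau l (- n) (- m) (swap_indices Y)"
proof -
  note s = antihol_swap[OF l mn]
  have eq: "(\<lambda>Z. tau_integral l (- n) (- m) (swap_indices Z)) = tau_integral l n m"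
    by (rule ext) (rule s(3))
  obtain c where c: "rational_value (tau_integral l (- n) (- m)) SU11 (swap_indices Y) c"
    using tau_hol(1)[OF l s(1,2), of "swap_indices Y"] Y by auto
  show ?thesis
    using tau_eqI[OF c] tau_eqI[OF rational_value_swap[OF c, unfolded eq]] by simp
qed

text \<open>The exchange of indices takes \<open>Gamma_plus\<close> to \<open>Gamma_minus\<close>
  and the weights to their negatives. The holomorphic result then applies with \<open>a\<close> and
  \<open>b\<close> interchanged.\<close>

lemma antihol_kernel_sum_over_weights:
  fixes W Z g :: "complex^2^2"
  assumes Z: "det Z \<noteq> 0" and g: "g \<in> SU11" and X: "W ** matrix_inv Z = g ** diag2 a b ** matrix_inv g"
    and G: "W ** matrix_inv Z \<in> Gamma_plus" and c: "composable 2 1 W Z" and l: "l = - 1 - real j / 2"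
  shows "((\<lambda>(m, n). kernel_term W Z l k m n) has_sum
    det Z powi (- 2) * (of_nat (Suc j) * (b * a) powi k / (b ^ Suc j * (b - a))))
      (antihol_weights l \<times> antihol_weights l)"
proof -
  have ls: "l \<in> spins" using l by (auto simp: spins_def)
  define W1 where "W1 = swap_indices W"
  define Z1 where "Z1 = swap_indices Z"
  have inv: "matrix_inv Z1 = swap_indices (matrix_inv Z)" unfolding Z1_def by (rule swap_indices_inv[OF Z, symmetric])
  have X1: "W1 ** matrix_inv Z1 = swap_indices (W ** matrix_inv Z)"
    unfolding inv W1_def swap_indices_mul ..
  from swap_indices_Gamma_plus[OF G] have G1: "W1 ** matrix_inv Z1 \<in> Gamma_minus" unfolding X1 .
  have c1: "composable 1 2 W1 Z1"
    using c unfolding composable_def inv W1_def maps_disc_swap .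
  have nz: "Y$2$2 \<noteq> 0" if "maps_disc 2 1 Y r s" "r > 0" for Y r s
    using maps_disc_den_nonzero[of "swap_indices Y" r s 0] that by (simp add: den_def maps_disc_swap)
  then have nz: "W$2$2 \<noteq> 0" "(matrix_inv Z)$2$2 \<noteq> 0" using c unfolding composable_def by blast+
  have kt: "kernel_term W Z l k m n = kernel_term W1 Z1 l k (- m) (- n)"
    if "m \<in> antihol_weights l" "n \<in> antihol_weights l" for m n
    using that tau_antihol_eq_swap[OF ls] nz
    by (simp add: kernel_term_def inv[unfolded Z1_def] W1_def Z1_def swap_indices_det)
  have iff: "- m \<in> hol_weights l \<longleftrightarrow> m \<in> antihol_weights l" for m
  proof -
    have "- m - l \<in> \<int> \<longleftrightarrow> m - l \<in> \<int>"
    proof -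
      have 2: "2 * l \<in> \<int>" using l by simp
      have "m - l = - (- m - l) - 2 * l" "- m - l = - (m - l) - 2 * l" by simp_all
      then show ?thesis using 2 by (metis Ints_diff Ints_minus)
    qed
    then show ?thesis by (auto simp: hol_weights_def antihol_weights_def)
  qed
  have "((\<lambda>(m, n). kernel_term W1 Z1 l k m n) has_sum
    det Z powi (- 2) * (of_nat (Suc j) * (b * a) powi k / (b ^ Suc j * (b - a))))
      (hol_weights l \<times> hol_weights l)"
  proof -
    have dZ: "det Z1 = det Z" by (simp add: Z1_def swap_indices_det)
    have "W1 ** matrix_inv Z1 = swap_indices g ** diag2 b a ** matrix_inv (swap_indices g)"
      unfolding X1 X swap_indices_conjugate[OF g] ..
    from hol_kernel_sum_over_weights[OF _ swap_indices_SU11[OF g] this G1 c1 l] show ?thesis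
      using Z unfolding dZ by blast
  qed
  also have "?this \<longleftrightarrow> ((\<lambda>(m, n). kernel_term W Z l k m n) has_sum
    det Z powi (- 2) * (of_nat (Suc j) * (b * a) powi k / (b ^ Suc j * (b - a))))
      (antihol_weights l \<times> antihol_weights l)"
    by (rule has_sum_reindex_bij_witness[where i = "\<lambda>(m, n). (- m, - n)" and j = "\<lambda>(m, n). (- m, - n)"])
       (use kt iff iff[of "- m" for m] in auto)
  finally show ?thesis .
qed

section \<open>The sums over \<open>k\<close> and \<open>l\<close>\<close>

lemma has_sum_imp_norm_summable_on:
  fixes f :: "'a \<Rightarrow> complex"
  shows "(f has_sum S) I \<Longrightarrow> (\<lambda>x. norm (f x)) summable_on I"
  using has_sum_imp_summable summable_on_iff_abs_summable_on_complex by blast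

text \<open>For complex terms \<open>has_sum\<close> already entails absolute summability, so it
  suffices to give the value at each of the three stages.\<close>

lemma has_abs_iterated_sumI:
  assumes "\<And>l k. l \<in> L \<Longrightarrow> k \<in> K l \<Longrightarrow> ((\<lambda>(m, n). f l k m n) has_sum A l k) (M l \<times> M l)"
    and "\<And>l. l \<in> L \<Longrightarrow> (A l has_sum B l) (K l)" and "(B has_sum S) L"
  shows "has_abs_iterated_sum f L K M S"
proof -
  have A: "(\<Sum>\<^sub>\<infinity>(m, n)\<in>M l \<times> M l. f l k m n) = A l k" if "l \<in> L" "k \<in> K l" for l k
    using assms(1)[OF that] by (rule infsumI)
  have B: "(\<Sum>\<^sub>\<infinity>k\<in>K l. \<Sum>\<^sub>\<infinity>(m, n)\<in>M l \<times> M l. f l k m n) = B l" if "l \<in> L" for l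
    using infsumI[OF assms(2)[OF that]] infsum_cong[of "K l", OF A[OF that]] by simp
  show ?thesis unfolding has_abs_iterated_sum_def
  proof (intro conjI ballI)
    show "(\<lambda>(m, n). norm (f l k m n)) summable_on M l \<times> M l" if "l \<in> L" "k \<in> K l" for l k
      using has_sum_imp_norm_summable_on[OF assms(1)[OF that]] by (simp add: case_prod_unfold)
  qed (use assms has_sum_imp_norm_summable_on[OF assms(2)] has_sum_imp_norm_summable_on[OF assms(3)] A B in \<open>auto cong: has_sum_cong summable_on_cong\<close>)
qed

lemma has_sum_Suc_power:
  fixes x :: complex
  assumes "norm x < 1"
  shows "((\<lambda>j. of_nat (Suc j) * x ^ Suc j) has_sum x / (1 - x)\<^sup>2) UNIV"
proof -
  have "((\<lambda>j. of_nat (Suc j) * x ^ j) has_sum 1 / (1 - x)\<^sup>2) UNIV"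
  proof (rule norm_summable_imp_has_sum)
    have "summable (\<lambda>j. of_nat (Suc j) * norm x ^ j)"
      using geometric_deriv_sums[of "norm x"] assms by (auto simp: sums_iff)
    then show "summable (\<lambda>j. norm (of_nat (Suc j) * x ^ j))"
      by (simp add: norm_mult norm_power del: of_nat_Suc)
  qed (rule geometric_deriv_sums[OF assms])
  from has_sum_cmult_right[OF this, of x] show ?thesis by (simp add: mult_ac)
qed

lemma has_sum_powi_negative:
  fixes x :: complex
  assumes "norm x > 1"
  shows "((\<lambda>k. x powi k) has_sum 1 / (x - 1)) {k. k \<le> - 1}"
proof -
  have x: "x \<noteq> 0" "x \<noteq> 1" "norm (1 / x) < 1" using assms by (auto simp: norm_divide divide_less_eq_1)
  have "((\<lambda>n. (1 / x) ^ n) has_sum 1 / (1 - 1 / x)) UNIV"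
    using x by (intro norm_summable_imp_has_sum geometric_sums) (auto simp: norm_power intro: summable_geometric)
  from has_sum_cmult_right[OF this, of "1 / x"]
  have "((\<lambda>n. x powi (- 1 - int n)) has_sum 1 / (x - 1)) UNIV"
    using x by (simp add: field_simps power_int_diff power_int_minus)
  also have "?this \<longleftrightarrow> ?thesis"
    by (rule has_sum_reindex_bij_witness[where i = "\<lambda>k. nat (- 1 - k)" and j = "\<lambda>n. - 1 - int n"]) auto
  finally show ?thesis .
qed

lemma has_sum_powi_from:
  fixes x :: complex
  assumes "norm x < 1" "x \<noteq> 0"
  shows "((\<lambda>k. x powi k) has_sum x ^ p / (1 - x)) {k. k \<ge> int p}"
proof -
  have "((\<lambda>n. x ^ n) has_sum 1 / (1 - x)) UNIV"
    using assms by (intro norm_summable_imp_has_sum geometric_sums) (auto simp: norm_power intro: summable_geometric)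
  from has_sum_cmult_right[OF this, of "x ^ p"]
  have "((\<lambda>n. x powi (int p + int n)) has_sum x ^ p / (1 - x)) UNIV"
    using assms by (simp add: power_int_add)
  also have "?this \<longleftrightarrow> ?thesis"
    by (rule has_sum_reindex_bij_witness[where i = "\<lambda>k. nat (k - int p)" and j = "\<lambda>n. int p + int n"]) auto
  finally show ?thesis .
qed

lemma has_sum_spins_iff:
  "(B has_sum S) spins \<longleftrightarrow> ((\<lambda>j. B (- 1 - real j / 2)) has_sum S) UNIV"
proof -
  have "spins = (\<lambda>j. - 1 - real j / 2) ` UNIV" by (auto simp: spins_def)
  moreover have "inj (\<lambda>j. - 1 - real j / 2)" by (auto simp: inj_on_def)
  ultimately show ?thesis using has_sum_reindex[of "\<lambda>j. - 1 - real j / 2" UNIV B S] by (simp add: o_def)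
qed

text \<open>The sum over \<open>k\<close> is a geometric series in \<open>1 / (a * b)\<close> and
  the sum over \<open>l\<close> a differentiated one in \<open>1 / a\<close>. Leaving
  \<open>M\<close> arbitrary covers both series, with the eigenvalues interchanged in the
  antiholomorphic case.\<close>

lemma kernel_sum_negative:
  assumes inner: "\<And>j k. ((\<lambda>(m, n). kernel_term W Z (- 1 - real j / 2) k m n) has_sum
      D * (of_nat (Suc j) * (a * b) powi k / (a ^ Suc j * (a - b)))) (M (- 1 - real j / 2) \<times> M (- 1 - real j / 2))"
    and a: "cmod a > 1" and N: "cmod (a * b) > 1"
  shows "has_abs_iterated_sum (kernel_term W Z) spins (\<lambda>l. {k. k \<le> - 1}) M
    (- D * a / ((a - b) * (1 - a * b) * (1 - a)\<^sup>2))"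
proof -
  \<comment> \<open>\<open>J\<close> recovers \<open>j\<close> from
    \<open>l = - 1 - real j / 2\<close>, so that the partial sums can be written as functions of
    \<open>l\<close>.\<close>
  define J where "J l = nat \<lfloor>- 2 * l - 2\<rfloor>" for l :: real
  have J: "J (- 1 - real j / 2) = j" for j by (simp add: J_def)
  define A where "A l k = (D / (a - b)) * (of_nat (Suc (J l)) * (1 / a) ^ Suc (J l)) * (a * b) powi k" for l k
  define B where "B l = (D / (a - b)) * (of_nat (Suc (J l)) * (1 / a) ^ Suc (J l)) * (1 / (a * b - 1))" for l
  have a0: "a \<noteq> 0" "a \<noteq> 1" "cmod (1 / a) < 1" using a by (auto simp: norm_divide divide_less_eq_1)
  show ?thesis
  proof (rule has_abs_iterated_sumI[where A = A and B = B])
    fix l k assume "l \<in> spins"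
    then obtain j where l: "l = - 1 - real j / 2" by (auto simp: spins_def)
    have "A l k = D * (of_nat (Suc j) * (a * b) powi k / (a ^ Suc j * (a - b)))"
      unfolding A_def l J by (simp add: power_divide mult_ac)
    then show "((\<lambda>(m, n). kernel_term W Z l k m n) has_sum A l k) (M l \<times> M l)"
      using inner[of j k] by (simp only: l)
  next
    fix l
    show "(A l has_sum B l) {k. k \<le> - 1}"
      unfolding A_def[abs_def] B_def by (intro has_sum_cmult_right has_sum_powi_negative N)
  next
    have "((\<lambda>j. (D / (a - b)) * (of_nat (Suc j) * (1 / a) ^ Suc j) * (1 / (a * b - 1))) has_sum
       (D / (a - b)) * ((1 / a) / (1 - 1 / a)\<^sup>2) * (1 / (a * b - 1))) UNIV"
      by (intro has_sum_cmult_left has_sum_cmult_right has_sum_Suc_power a0)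
    moreover have "(D / (a - b)) * ((1 / a) / (1 - 1 / a)\<^sup>2) * (1 / (a * b - 1)) =
       - D * a / ((a - b) * (1 - a * b) * (1 - a)\<^sup>2)"
    proof -
      have 1: "(1 / a) / (1 - 1 / a)\<^sup>2 = a / (1 - a)\<^sup>2"
        using a0 by (simp add: power2_eq_square divide_simps) (simp add: algebra_simps)
      have "1 / (a * b - 1) = - 1 / (1 - a * b)" by (metis minus_diff_eq minus_divide_right minus_divide_left)
      then show ?thesis unfolding 1 by simp
    qed
    ultimately show "(B has_sum - D * a / ((a - b) * (1 - a * b) * (1 - a)\<^sup>2)) spins"
      unfolding has_sum_spins_iff B_def J by simp
  qed
qed

text \<open>The sum over \<open>k\<close> starts at \<open>Suc j\<close> and contributes
  \<open>(a * b) ^ Suc j\<close>. This cancels \<open>a ^ Suc j\<close> in the character, so a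
  differentiated geometric series in \<open>b\<close> remains.\<close>

lemma kernel_sum_nonnegative:
  assumes inner: "\<And>j k. ((\<lambda>(m, n). kernel_term W Z (- 1 - real j / 2) k m n) has_sum
      D * (of_nat (Suc j) * (a * b) powi k / (a ^ Suc j * (a - b)))) (M (- 1 - real j / 2) \<times> M (- 1 - real j / 2))"
    and b: "cmod b < 1" and ab: "a \<noteq> 0" "b \<noteq> 0" and N: "cmod (a * b) < 1"
  shows "has_abs_iterated_sum (kernel_term W Z) spins (\<lambda>l. {k. real_of_int k \<ge> - (2 * l + 1)}) M
    (D * b / ((a - b) * (1 - a * b) * (1 - b)\<^sup>2))"
proof -
  define J where "J l = nat \<lfloor>- 2 * l - 2\<rfloor>" for l :: real
  have J: "J (- 1 - real j / 2) = j" for j by (simp add: J_def)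
  define A where "A l k = (D / (a - b)) * (of_nat (Suc (J l)) * (1 / a) ^ Suc (J l)) * (a * b) powi k" for l k
  define B where "B l = (D / (a - b)) * (of_nat (Suc (J l)) * b ^ Suc (J l)) * (1 / (1 - a * b))" for l
  show ?thesis
  proof (rule has_abs_iterated_sumI[where A = A and B = B])
    fix l k assume "l \<in> spins"
    then obtain j where l: "l = - 1 - real j / 2" by (auto simp: spins_def)
    have "A l k = D * (of_nat (Suc j) * (a * b) powi k / (a ^ Suc j * (a - b)))"
      unfolding A_def l J by (simp add: power_divide mult_ac)
    then show "((\<lambda>(m, n). kernel_term W Z l k m n) has_sum A l k) (M l \<times> M l)"
      using inner[of j k] by (simp only: l)
  next
    fix l assume "l \<in> spins"
    then obtain j where l: "l = - 1 - real j / 2" by (auto simp: spins_def)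
    have K: "{k. real_of_int k \<ge> - (2 * l + 1)} = {k. k \<ge> int (Suc j)}" using l by auto
    have "((\<lambda>k. (a * b) powi k) has_sum (a * b) ^ Suc j / (1 - a * b)) {k. k \<ge> int (Suc j)}"
      by (rule has_sum_powi_from) (use N ab in auto)
    from has_sum_cmult_right[OF this, of "(D / (a - b)) * (of_nat (Suc j) * (1 / a) ^ Suc j)"]
    show "(A l has_sum B l) {k. real_of_int k \<ge> - (2 * l + 1)}"
      unfolding A_def[abs_def] B_def K unfolding l J using ab
      by (simp add: power_divide power_mult_distrib)
  next
    have "((\<lambda>j. (D / (a - b)) * (of_nat (Suc j) * b ^ Suc j) * (1 / (1 - a * b))) has_sum
       (D / (a - b)) * (b / (1 - b)\<^sup>2) * (1 / (1 - a * b))) UNIV"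
      by (intro has_sum_cmult_left has_sum_cmult_right has_sum_Suc_power b)
    then show "(B has_sum D * b / ((a - b) * (1 - a * b) * (1 - b)\<^sup>2)) spins"
      unfolding has_sum_spins_iff B_def J by (simp add: mult_ac)
  qed
qed

section \<open>The four kernel expansions\<close>

theorem proposition8:
  fixes W Z g :: "complex^2^2" and lambda1 lambda2 :: complex
  assumes "invertible Z"
    and "g \<in> SU11" and "W ** matrix_inv Z = g ** diag2 lambda1 lambda2 ** matrix_inv g"
  shows
    "(W ** matrix_inv Z \<in> Gamma_minus \<and> composable 1 2 W Z \<and> cmod (det (W ** matrix_inv Z)) > 1 \<longrightarrow>
        has_abs_iterated_sum (kernel_term W Z) spins (\<lambda>l. {k. k \<le> - 1}) hol_weights
          (- (det Z powi (- 2)) * lambda1 / ((lambda1 - lambda2) * (1 - lambda1 * lambda2) * (1 - lambda1)\<^sup>2))) \<and>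
     (W ** matrix_inv Z \<in> Gamma_minus \<and> composable 1 2 W Z \<and> cmod (det (W ** matrix_inv Z)) < 1 \<longrightarrow>
        has_abs_iterated_sum (kernel_term W Z) spins (\<lambda>l. {k. real_of_int k \<ge> - (2 * l + 1)}) hol_weights
          (det Z powi (- 2) * lambda2 / ((lambda1 - lambda2) * (1 - lambda1 * lambda2) * (1 - lambda2)\<^sup>2))) \<and>
     (W ** matrix_inv Z \<in> Gamma_plus \<and> composable 2 1 W Z \<and> cmod (det (W ** matrix_inv Z)) > 1 \<longrightarrow>
        has_abs_iterated_sum (kernel_term W Z) spins (\<lambda>l. {k. k \<le> - 1}) antihol_weights
          (det Z powi (- 2) * lambda2 / ((lambda1 - lambda2) * (1 - lambda1 * lambda2) * (1 - lambda2)\<^sup>2))) \<and>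
     (W ** matrix_inv Z \<in> Gamma_plus \<and> composable 2 1 W Z \<and> cmod (det (W ** matrix_inv Z)) < 1 \<longrightarrow>
        has_abs_iterated_sum (kernel_term W Z) spins (\<lambda>l. {k. real_of_int k \<ge> - (2 * l + 1)}) antihol_weights
          (- (det Z powi (- 2)) * lambda1 / ((lambda1 - lambda2) * (1 - lambda1 * lambda2) * (1 - lambda1)\<^sup>2)))"
proof -
  note g = assms(2) and X = assms(3)
  have Z: "det Z \<noteq> 0" using assms(1) by (simp add: invertible_det_nz)
  have N: "det (W ** matrix_inv Z) = lambda1 * lambda2" unfolding X by (rule det_conjugate_diag2[OF g])
  note hol = hol_kernel_sum_over_weights[OF Z g X _ _ refl]
    and antihol = antihol_kernel_sum_over_weights[OF Z g X _ _ refl]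
    and hol_ev = Gamma_minus_eigenvalues[OF g, of lambda1 lambda2, folded X]
    and antihol_ev = Gamma_plus_eigenvalues[OF g, of lambda1 lambda2, folded X]
  \<comment> \<open>In the antiholomorphic case the sums are evaluated with the eigenvalues
    interchanged, which changes the sign of their difference.\<close>
  have minus: "- D * b / ((b - a) * (1 - b * a) * c) = D * b / ((a - b) * (1 - a * b) * c)"
      "D * a / ((b - a) * (1 - b * a) * c) = - D * a / ((a - b) * (1 - a * b) * c)" for D a b c :: complex
  proof -
    have "(b - a) * (1 - b * a) * c = - ((a - b) * (1 - a * b) * c)" by (simp add: algebra_simps)
    then show "- D * b / ((b - a) * (1 - b * a) * c) = D * b / ((a - b) * (1 - a * b) * c)"
      "D * a / ((b - a) * (1 - b * a) * c) = - D * a / ((a - b) * (1 - a * b) * c)" by simp_all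
  qed
  show ?thesis
  proof (intro conjI impI; elim conjE)
    assume *: "W ** matrix_inv Z \<in> Gamma_minus" "composable 1 2 W Z"
    {
      assume "cmod (det (W ** matrix_inv Z)) > 1"
      then show "has_abs_iterated_sum (kernel_term W Z) spins (\<lambda>l. {k. k \<le> - 1}) hol_weights
          (- (det Z powi (- 2)) * lambda1 / ((lambda1 - lambda2) * (1 - lambda1 * lambda2) * (1 - lambda1)\<^sup>2))"
        using hol[OF *] hol_ev[OF *(1)] unfolding N by (intro kernel_sum_negative)
    next
      assume "cmod (det (W ** matrix_inv Z)) < 1"
      then show "has_abs_iterated_sum (kernel_term W Z) spins (\<lambda>l. {k. real_of_int k \<ge> - (2 * l + 1)}) hol_weights
          (det Z powi (- 2) * lambda2 / ((lambda1 - lambda2) * (1 - lambda1 * lambda2) * (1 - lambda2)\<^sup>2))"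
        using hol[OF *] hol_ev[OF *(1)] unfolding N by (intro kernel_sum_nonnegative) auto
    }
  next
    assume *: "W ** matrix_inv Z \<in> Gamma_plus" "composable 2 1 W Z"
    {
      assume "cmod (det (W ** matrix_inv Z)) > 1"
      then show "has_abs_iterated_sum (kernel_term W Z) spins (\<lambda>l. {k. k \<le> - 1}) antihol_weights
          (det Z powi (- 2) * lambda2 / ((lambda1 - lambda2) * (1 - lambda1 * lambda2) * (1 - lambda2)\<^sup>2))"
        using antihol[OF *] antihol_ev[OF *(1)] unfolding N
        by (subst minus(1)[symmetric], intro kernel_sum_negative) (simp_all add: mult.commute)
    next
      assume "cmod (det (W ** matrix_inv Z)) < 1"
      then show "has_abs_iterated_sum (kernel_term W Z) spins (\<lambda>l. {k. real_of_int k \<ge> - (2 * l + 1)}) antihol_weights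
          (- (det Z powi (- 2)) * lambda1 / ((lambda1 - lambda2) * (1 - lambda1 * lambda2) * (1 - lambda1)\<^sup>2))"
        using antihol[OF *] antihol_ev[OF *(1)] unfolding N
        by (subst minus(2)[symmetric], intro kernel_sum_nonnegative) (auto simp: mult.commute)
    }
  qed
qed

end
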